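(* For every $\varepsilon>0$ there exists $n_0$ such that the following holds for all $n\ge n_0$ and $d\ge 2$. Consider an evolution, on the time interval $(-\infty,\infty)$, of $n$ hard balls $B_1,\dots,B_n$ in $\mathbb{R}^d$ of equal masses and radii $1$, colliding elastically, with no simultaneous collisions. If the total number of collisions is greater than or equal to $n^{(5/2+\varepsilon)n}$, then there exist a family $\mathcal{B}=\{B_{i_1},\dots,B_{i_k}\}$ of balls and an interval $[t_1,t_2]$ such that $\mathcal{B}$ is $n^{-n}$-connected in $[t_1,t_2]$ and there are more than $n^{\varepsilon n/2}$ collisions among balls in $\mathcal{B}$ on $[t_1,t_2]$.
   Context: Hard ball dynamics: $n$ balls in $\mathbb{R}^d$ have radius $1$ and equal masses. The centers $x^k(t)$ are continuous functions of $t\in\mathbb{R}$ with $|x^j(t)-x^k(t)|\ge 2$ for $j\ne k$ (balls do not overlap), and velocities $v^k$ are constant between collisions. Balls $j$ and $k$ collide at time $t$ if $|x^j(t)-x^k(t)|=2$ and their velocities change at time $t$. In that case the velocities just before the collision satisfy $(v^j(t-)-v^k(t-))\cdot(x^j(t)-x^k(t))<0$ and, with $x^{jk}(t)=(x^j(t)-x^k(t))/|x^j(t)-x^k(t)|$, $$v^j(t+)=v^j(t-)+(v^k(t-)\cdot x^{jk}(t))x^{jk}(t)-(v^j(t-)\cdot x^{jk}(t))x^{jk}(t),$$ $$v^k(t+)=v^k(t-)+(v^j(t-)\cdot x^{jk}(t))x^{jk}(t)-(v^k(t-)\cdot x^{jk}(t))x^{jk}(t).$$ The velocity of a ball changes only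 at its collisions. No simultaneous collisions: there is no time $t$ and no collection of at least three balls such that any two balls of the collection are linked by a chain of balls in which consecutive balls are in contact at time $t$. (Two disjoint touching pairs at the same time are allowed.) Consequently there are only finitely many collisions in every finite time interval. $\rho$-connectedness: for $\rho>0$, $\Gamma_\rho(t)$ is the graph with vertices $B_1,\dots,B_n$ in which $B_j$ and $B_k$ are joined by an edge if and only if $|x^j(t)-x^k(t)|\le 2+\rho$. A subfamily $\{B_{i_1},\dots,B_{i_k}\}$ is $\rho$-connected in $[s,u]$ if for every $t\in[s,u]$ all the balls $B_{i_1},\dots,B_{i_k}$ belong to one connected component of $\Gamma_\rho(t)$ (the component may depend on $t$ and may contain other balls). A collision among balls in $\mathcal{B}$ is a collision between two balls both belonging to $\mathcal{B}$. *)

theory Defs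
  imports "HOL-Analysis.Analysis"
begin

text \<open>
  The bound on the number of balls has to be uniform in the dimension, so \<open>d\<close> is a number and
  not a type: points and vectors of $R^d$ are functions \<open>nat \<Rightarrow> real\<close> in
  \<open>topspace (Euclidean_space d)\<close>, that is, vanishing at all indices \<open>\<ge> d\<close>.
  The balls are \<open>0, \<dots>, n - 1\<close>, and \<open>x k t\<close> is the centre of ball \<open>k\<close> at time \<open>t\<close>.
\<close>

type_synonym point = "nat \<Rightarrow> real"
type_synonym motion = "nat \<Rightarrow> real \<Rightarrow> point"

definition inner_d :: "nat \<Rightarrow> point \<Rightarrow> point \<Rightarrow> real" where
  "inner_d d u w = (\<Sum>i<d. u i * w i)"

definition dist_d :: "nat \<Rightarrow> point \<Rightarrow> point \<Rightarrow> real" where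
  "dist_d d u w = L2_set (\<lambda>i. u i - w i) {..<d}"

text \<open>The one-sided velocities $v^k(t-)$ and $v^k(t+)$ are the one-sided derivatives of the
  centre; their existence is part of \<open>hard_ball_evolution\<close>.\<close>

definition vel_before :: "motion \<Rightarrow> nat \<Rightarrow> real \<Rightarrow> point" where
  "vel_before x k t = (\<lambda>i. vector_derivative (\<lambda>s. x k s i) (at_left t))"

definition vel_after :: "motion \<Rightarrow> nat \<Rightarrow> real \<Rightarrow> point" where
  "vel_after x k t = (\<lambda>i. vector_derivative (\<lambda>s. x k s i) (at_right t))"

definition touch :: "nat \<Rightarrow> nat \<Rightarrow> motion \<Rightarrow> real \<Rightarrow> nat \<Rightarrow> nat \<Rightarrow> bool" where
  "touch d n x t j k \<longleftrightarrow> j < n \<and> k < n \<and> j \<noteq> k \<and> dist_d d (x j t) (x k t) = 2"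

definition collide :: "nat \<Rightarrow> nat \<Rightarrow> motion \<Rightarrow> nat \<Rightarrow> nat \<Rightarrow> real \<Rightarrow> bool" where
  "collide d n x j k t \<longleftrightarrow> touch d n x t j k \<and>
     vel_before x j t \<noteq> vel_after x j t \<and> vel_before x k t \<noteq> vel_after x k t"

text \<open>Each collision is counted once: the pair is listed in increasing order.\<close>

definition collisions :: "nat \<Rightarrow> nat \<Rightarrow> motion \<Rightarrow> (nat \<times> nat \<times> real) set" where
  "collisions d n x = {(j, k, t). j < k \<and> collide d n x j k t}"

definition collisions_among ::
    "nat \<Rightarrow> nat \<Rightarrow> motion \<Rightarrow> nat set \<Rightarrow> real set \<Rightarrow> (nat \<times> nat \<times> real) set" where
  "collisions_among d n x B T = {(j, k, t) \<in> collisions d n x. j \<in> B \<and> k \<in> B \<and> t \<in> T}"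

definition unit_normal :: "nat \<Rightarrow> motion \<Rightarrow> nat \<Rightarrow> nat \<Rightarrow> real \<Rightarrow> point" where
  "unit_normal d x j k t = (\<lambda>i. (x j t i - x k t i) / dist_d d (x j t) (x k t))"

definition elastic_law :: "nat \<Rightarrow> motion \<Rightarrow> nat \<Rightarrow> nat \<Rightarrow> real \<Rightarrow> bool" where
  "elastic_law d x j k t \<longleftrightarrow>
    (let e = unit_normal d x j k t; vj = vel_before x j t; vk = vel_before x k t in
       inner_d d (\<lambda>i. vj i - vk i) (\<lambda>i. x j t i - x k t i) < 0 \<and>
       vel_after x j t = (\<lambda>i. vj i + inner_d d vk e * e i - inner_d d vj e * e i) \<and>
       vel_after x k t = (\<lambda>i. vk i + inner_d d vj e * e i - inner_d d vk e * e i))"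

definition hard_ball_evolution :: "nat \<Rightarrow> nat \<Rightarrow> motion \<Rightarrow> bool" where
  "hard_ball_evolution d n x \<longleftrightarrow>
     (\<forall>k<n. continuous_map euclideanreal (Euclidean_space d) (x k)) \<and>
     (\<forall>j<n. \<forall>k<n. \<forall>t. j \<noteq> k \<longrightarrow> 2 \<le> dist_d d (x j t) (x k t)) \<and>
     (\<forall>k<n. \<forall>t i. (\<lambda>s. x k s i) differentiable at_left t \<and>
                   (\<lambda>s. x k s i) differentiable at_right t) \<and>
     (\<forall>k<n. \<forall>a b. (\<forall>t\<in>{a<..<b}. \<forall>j. \<not> collide d n x j k t) \<longrightarrow>
        (\<exists>v. \<forall>t\<in>{a<..<b}. \<forall>i. ((\<lambda>s. x k s i) has_real_derivative v i) (at t))) \<and>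
     (\<forall>k<n. \<forall>t. vel_before x k t \<noteq> vel_after x k t \<longrightarrow> (\<exists>j. collide d n x j k t)) \<and>
     (\<forall>j k t. collide d n x j k t \<longrightarrow> elastic_law d x j k t)"

text \<open>Contacts are what is restricted here, whether or not the velocities change.\<close>

definition no_simultaneous_collisions :: "nat \<Rightarrow> nat \<Rightarrow> motion \<Rightarrow> bool" where
  "no_simultaneous_collisions d n x \<longleftrightarrow>
     \<not> (\<exists>t S. S \<subseteq> {..<n} \<and> 3 \<le> card S \<and> (\<forall>j\<in>S. \<forall>k\<in>S. (touch d n x t)\<^sup>*\<^sup>* j k))"

definition Gamma_edges :: "nat \<Rightarrow> nat \<Rightarrow> motion \<Rightarrow> real \<Rightarrow> real \<Rightarrow> (nat \<times> nat) set" where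
  "Gamma_edges d n x \<rho> t =
     {(j, k). j < n \<and> k < n \<and> j \<noteq> k \<and> dist_d d (x j t) (x k t) \<le> 2 + \<rho>}"

definition Gamma_components :: "nat \<Rightarrow> nat \<Rightarrow> motion \<Rightarrow> real \<Rightarrow> real \<Rightarrow> nat set set" where
  "Gamma_components d n x \<rho> t = {..<n} // ((Gamma_edges d n x \<rho> t)\<^sup>*)"

definition rho_connected ::
    "nat \<Rightarrow> nat \<Rightarrow> motion \<Rightarrow> real \<Rightarrow> nat set \<Rightarrow> real set \<Rightarrow> bool" where
  "rho_connected d n x \<rho> B T \<longleftrightarrow>
     (\<forall>t\<in>T. \<exists>C\<in>Gamma_components d n x \<rho> t. B \<subseteq> C)"

end

(* Put K = n^(eps n / 2) and rho = n^(-n), and suppose that every rho-connected family has at most K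
   collisions; we bound the total number of collisions.  Consider a family of m balls that meets no
   other ball, in the frame of its centre of mass, as one point X of Euclidean space with velocity V.
   Here |V| is constant and X . V grows at rate |V|^2 between collisions and jumps upwards at
   collisions.  Hence |X| < R only during a time 2R / |V|, and while X is nonzero the direction X / |X|
   turns by at most the decrease of the angle between X and V, so by at most pi in total.

   If |X| >= 8 m^(3/2), the configuration has a gap of relative size m^(-3/2), and the two sides of the
   gap cannot touch until the direction has turned by m^(-3/2) / 4: up to O(m^(3/2)) times the family
   splits into smaller ones.  The remaining time, of length 16 m^(3/2) / |V|, is cut into pieces of
   length rho / (2 |V|), on which no distance changes by more than rho, so that colliding balls
   stay rho-connected and each piece has at most n K collisions.  Induction on m gives at most
   (112 n^(3/2))^(n-1) (32 n^(3/2) / rho + 1) n K collisions. *)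

theory Submission
  imports Defs
begin

section \<open>Straight paths with outward kicks\<close>

text \<open>The time spent at large radius has no bound, so it cannot be cut by length. The angle
  between position and velocity is the clock instead: it only decreases while the radius is nonzero,
  so equal steps of the angle are consecutive time windows, and their number depends neither on
  elapsed time nor on speed. The dimension stays out because the gap is sought among the distances
  to one ball, on a half-line: reaching a ball at distance 1 / sqrt m and cutting that distance into
  m slots gives m^(-3/2). Two sides of a gap may meet again in a later window, so the induction
  needs a bound valid for every family on every interval on which it meets no other ball.

  The exponent 5/2 is 3/2 + 1: every level of the induction multiplies by a constant times n^(3/2),
  while 1 / rho = n^n enters as a factor only once, since the term that the close stage adds at each
  level is dominated by the recursive one. Of the surplus eps, one half is K and the other absorbs
  the constant to the power n.\<close>

lemma L2_set_sq: "(L2_set f A)\<^sup>2 = (\<Sum>i\<in>A. (f i)\<^sup>2)"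
  by (simp add: L2_set_def sum_nonneg)

lemma abs_sum_mult_le_L2: "\<bar>\<Sum>i\<in>A. f i * g i\<bar> \<le> L2_set f A * L2_set g A"
proof -
  have "\<bar>\<Sum>i\<in>A. f i * g i\<bar> \<le> (\<Sum>i\<in>A. \<bar>f i\<bar> * \<bar>g i\<bar>)"
    using sum_abs[of "\<lambda>i. f i * g i" A] by (simp add: abs_mult)
  also have "\<dots> \<le> L2_set f A * L2_set g A" by (rule L2_set_mult_ineq)
  finally show ?thesis .
qed

lemma L2_set_diff_triangle:
  "L2_set (\<lambda>i. f i - h i) A \<le> L2_set (\<lambda>i. f i - g i) A + L2_set (\<lambda>i. g i - h i) A"
  using L2_set_triangle_ineq[of "\<lambda>i. f i - g i" "\<lambda>i. g i - h i" A] by simp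

lemma L2_set_minus_commute: "L2_set (\<lambda>i. f i - g i) A = L2_set (\<lambda>i. g i - f i) A"
  by (simp add: L2_set_def power2_commute)

lemma L2_set_diff_ge: "L2_set f A - L2_set g A \<le> L2_set (\<lambda>i. f i - g i) A"
  using L2_set_triangle_ineq[of "\<lambda>i. f i - g i" g A] by simp

text \<open>On a ray, the angle between two positions is the difference of their angles to the velocity,
  by the addition formula for the cosine; a chord is no longer than its arc.\<close>

lemma chord_le_angle:
  fixes X X' w :: "'i \<Rightarrow> real" and J :: "'i set"
  defines "V \<equiv> L2_set w J" and "r \<equiv> L2_set X J" and "r' \<equiv> L2_set X' J"
  defines "f \<equiv> \<Sum>i\<in>J. X i * w i" and "f' \<equiv> \<Sum>i\<in>J. X' i * w i"
  assumes "finite J" and \<tau>: "0 \<le> \<tau>" and X': "\<And>i. i \<in> J \<Longrightarrow> X' i = X i + \<tau> * w i"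
    and pos: "V > 0" "r > 0" "r' > 0"
  shows "f / (r * V) \<le> f' / (r' * V)" 
    and "L2_set (\<lambda>i. X' i / r' - X i / r) J \<le> arccos (f / (r * V)) - arccos (f' / (r' * V))"
proof -
  have V2: "V\<^sup>2 = (\<Sum>i\<in>J. (w i)\<^sup>2)" and r2: "r\<^sup>2 = (\<Sum>i\<in>J. (X i)\<^sup>2)"
    and r'2: "r'\<^sup>2 = (\<Sum>i\<in>J. (X' i)\<^sup>2)"
    by (simp_all add: V_def r_def r'_def L2_set_sq)
  have f': "f' = f + \<tau> * V\<^sup>2"
    unfolding f'_def f_def V2
    by (simp add: X' algebra_simps sum.distrib sum_distrib_left power2_eq_square cong: sum.cong)
  have "r'\<^sup>2 = (\<Sum>i\<in>J. (X i + \<tau> * w i)\<^sup>2)"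
    unfolding r'2 by (simp add: X')
  also have "\<dots> = r\<^sup>2 + 2 * \<tau> * f + \<tau>\<^sup>2 * V\<^sup>2"
    unfolding r2 V2 f_def
    by (simp add: power2_sum power_mult_distrib sum.distrib sum_distrib_left algebra_simps)
  finally have r'eq: "r'\<^sup>2 = r\<^sup>2 + 2 * \<tau> * f + \<tau>\<^sup>2 * V\<^sup>2" .
  have XX': "(\<Sum>i\<in>J. X i * X' i) = r\<^sup>2 + \<tau> * f"
    unfolding r2 f_def
    by (simp add: X' algebra_simps sum.distrib sum_distrib_left power2_eq_square cong: sum.cong)
  have cs: "\<bar>f\<bar> \<le> r * V" "\<bar>f'\<bar> \<le> r' * V"
    unfolding f_def f'_def r_def r'_def V_def by (rule abs_sum_mult_le_L2)+
  have rr1: "r' \<le> r + \<tau> * V"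
  proof -
    have "r' \<le> L2_set (\<lambda>i. X i + \<tau> * w i) J" unfolding r'_def
      by (rule eq_refl) (rule L2_set_cong, auto simp: X')
    also have "\<dots> \<le> r + L2_set (\<lambda>i. \<tau> * w i) J" unfolding r_def by (rule L2_set_triangle_ineq)
    also have "L2_set (\<lambda>i. \<tau> * w i) J = \<tau> * V" unfolding V_def using \<tau> by (simp add: L2_set_right_distrib)
    finally show ?thesis .
  qed
  have rr2: "r \<le> r' + \<tau> * V"
  proof -
    have "r \<le> L2_set (\<lambda>i. X' i + - \<tau> * w i) J" unfolding r_def
      by (rule eq_refl) (rule L2_set_cong, auto simp: X')
    also have "\<dots> \<le> r' + L2_set (\<lambda>i. - \<tau> * w i) J" unfolding r'_def by (rule L2_set_triangle_ineq)
    also have "L2_set (\<lambda>i. - \<tau> * w i) J = L2_set (\<lambda>i. \<tau> * w i) J" by (simp add: L2_set_def)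
    also have "L2_set (\<lambda>i. \<tau> * w i) J = \<tau> * V" unfolding V_def using \<tau> by (simp add: L2_set_right_distrib)
    finally show ?thesis .
  qed
  have ff: "f \<le> f'" unfolding f' using \<tau> by simp
  \<comment> \<open>The cosine grows along the ray. The sign of \<open>f\<close> decides which
    triangle inequality is sharp enough: \<open>rr1\<close> when the motion is already outward,
    \<open>rr2\<close> when it is inward up to the end.\<close>
  have "f * r' \<le> f' * r"
  proof (cases "f \<ge> 0")
    case True
    have "f * r' \<le> f * (r + \<tau> * V)" using True rr1 by (rule mult_left_mono[rotated])
    also have "\<dots> = f * r + f * (\<tau> * V)" by (simp add: algebra_simps)
    also have "f * (\<tau> * V) \<le> (r * V) * (\<tau> * V)"
      using cs(1) \<tau> pos by (intro mult_right_mono) auto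
    finally show ?thesis unfolding f' by (simp add: algebra_simps power2_eq_square)
  next
    case False
    show ?thesis
    proof (cases "f' \<ge> 0")
      case True
      have "f * r' \<le> 0" using False pos by (simp add: mult_nonpos_nonneg)
      also have "0 \<le> f' * r" using True pos by simp
      finally show ?thesis .
    next
      case f'neg: False
      have "(- f') * r \<le> (- f') * (r' + \<tau> * V)" using f'neg rr2 by (intro mult_left_mono) auto
      also have "\<dots> = (- f') * r' + (- f') * (\<tau> * V)" by (simp add: algebra_simps)
      also have "(- f') * (\<tau> * V) \<le> (r' * V) * (\<tau> * V)"
        using cs(2) \<tau> pos by (intro mult_right_mono) auto
      finally show ?thesis unfolding f' by (simp add: algebra_simps power2_eq_square)
    qed
  qed
  then show cc: "f / (r * V) \<le> f' / (r' * V)"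
    using pos by (simp add: field_simps)
  define c where "c = f / (r * V)"
  define c' where "c' = f' / (r' * V)"
  have c1: "-1 \<le> c" "c \<le> 1" "-1 \<le> c'" "c' \<le> 1"
    using cs pos unfolding c_def c'_def by (auto simp: field_simps abs_le_iff)
  \<comment> \<open>The Gram determinant of position and velocity, that is, the squared area they
    span. Adding a multiple of \<open>w\<close> to \<open>X\<close> leaves it unchanged, so both
    sines have the same numerator \<open>sqrt L\<close>.\<close>
  define L where "L = r\<^sup>2 * V\<^sup>2 - f\<^sup>2"
  have L': "L = r'\<^sup>2 * V\<^sup>2 - f'\<^sup>2"
    unfolding L_def r'eq f' by (simp add: power2_eq_square algebra_simps)
  have L0: "0 \<le> L" unfolding L_def using abs_le_square_iff[of f "r*V"] cs(1) pos
    by (simp add: power_mult_distrib)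
  have s: "sqrt (1 - c\<^sup>2) = sqrt L / (r * V)" 
  proof -
    have "1 - c\<^sup>2 = L / (r * V)\<^sup>2" unfolding c_def L_def using pos
      by (simp add: power_divide field_simps power_mult_distrib)
    then show ?thesis using pos by (simp add: real_sqrt_divide)
  qed
  have s': "sqrt (1 - c'\<^sup>2) = sqrt L / (r' * V)" 
  proof -
    have "1 - c'\<^sup>2 = L / (r' * V)\<^sup>2" unfolding c'_def L' using pos
      by (simp add: power_divide field_simps power_mult_distrib)
    then show ?thesis using pos by (simp add: real_sqrt_divide)
  qed
  define \<alpha> where "\<alpha> = arccos c - arccos c'"
  have \<alpha>0: "0 \<le> \<alpha>" unfolding \<alpha>_def using arccos_le_arccos[of c c'] cc c1 by (simp add: c_def c'_def)
  have "cos \<alpha> = c * c' + sqrt (1 - c\<^sup>2) * sqrt (1 - c'\<^sup>2)"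
    unfolding \<alpha>_def using c1 by (simp add: cos_diff sin_arccos)
  also have "\<dots> = (f * f' + L) / (r * r' * V\<^sup>2)"
    unfolding s s' unfolding c_def c'_def using pos L0
    by (simp add: field_simps power2_eq_square)
  also have "f * f' + L = V\<^sup>2 * (r\<^sup>2 + \<tau> * f)"
    unfolding L_def f' by (simp add: power2_eq_square algebra_simps)
  finally have cosa: "cos \<alpha> = (r\<^sup>2 + \<tau> * f) / (r * r')" using pos by simp
  have "(L2_set (\<lambda>i. X' i / r' - X i / r) J)\<^sup>2
      = (\<Sum>i\<in>J. (X' i)\<^sup>2 / r'\<^sup>2 + (X i)\<^sup>2 / r\<^sup>2 - 2 * (X i * X' i) / (r * r'))"
    unfolding L2_set_sq by (rule sum.cong) (auto simp: power2_diff power_divide mult_ac)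
  also have "\<dots> = r'\<^sup>2 / r'\<^sup>2 + r\<^sup>2 / r\<^sup>2 - 2 * (\<Sum>i\<in>J. X i * X' i) / (r * r')"
    by (simp add: sum.distrib sum_subtractf sum_distrib_left r2 r'2 flip: sum_divide_distrib)
  also have "\<dots> = 2 - 2 * cos \<alpha>" unfolding XX' cosa using pos by (simp add: field_simps)
  also have "\<dots> = (2 * sin (\<alpha> / 2))\<^sup>2"
    using cos_double_sin[of "\<alpha> / 2"] by (simp add: power_mult_distrib)
  also have "\<dots> \<le> \<alpha>\<^sup>2"
    using abs_sin_x_le_abs_x[of "\<alpha> / 2"] by (subst abs_le_square_iff[symmetric]) (simp add: abs_mult)
  finally have "L2_set (\<lambda>i. X' i / r' - X i / r) J \<le> \<alpha>"
    using \<alpha>0 by (rule power2_le_imp_le)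
  then show "L2_set (\<lambda>i. X' i / r' - X i / r) J \<le> arccos (f / (r * V)) - arccos (f' / (r' * V))"
    by (simp add: \<alpha>_def c_def c'_def)
qed

text \<open>\<open>W s\<close> is the velocity just after \<open>s\<close>. Each condition speaks of
  one flight from \<open>s\<close> to \<open>u\<close> followed by the kick at \<open>u\<close>, if
  there is one: \<open>W s\<close> arrives at \<open>u\<close> and \<open>W u\<close> leaves, so
  \<open>outward\<close> compares the two at the same position \<open>X u\<close>. Kicks at
  \<open>s\<close> and \<open>u\<close> themselves are therefore allowed.\<close>

locale expanding_path =
  fixes J :: "'i set" and X W :: "real \<Rightarrow> 'i \<Rightarrow> real" and a b :: real and C :: "real set"
  assumes finJ: "finite J" and finC: "finite C"
    and free: "\<And>s u i. \<lbrakk>a \<le> s; s \<le> u; u \<le> b; C \<inter> {s<..<u} = {}; i \<in> J\<rbrakk>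
                \<Longrightarrow> X u i = X s i + (u - s) * W s i"
    and energy: "\<And>s u. \<lbrakk>a \<le> s; s \<le> u; u \<le> b; C \<inter> {s<..<u} = {}\<rbrakk>
                \<Longrightarrow> (\<Sum>i\<in>J. (W u i)\<^sup>2) = (\<Sum>i\<in>J. (W s i)\<^sup>2)"
    and outward: "\<And>s u. \<lbrakk>a \<le> s; s \<le> u; u \<le> b; C \<inter> {s<..<u} = {}\<rbrakk>
                \<Longrightarrow> (\<Sum>i\<in>J. X u i * W s i) \<le> (\<Sum>i\<in>J. X u i * W u i)"
begin

section \<open>Radius, speed, outflow and angle along a path\<close>

definition rad :: "real \<Rightarrow> real" where "rad t = L2_set (X t) J"
definition speed :: real where "speed = L2_set (W a) J"
text \<open>Half the derivative of the squared radius during flight.\<close>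

definition outflow :: "real \<Rightarrow> real" where "outflow t = (\<Sum>i\<in>J. X t i * W t i)"
text \<open>The angle between position and velocity. It has this meaning only where
  \<open>rad t\<close> and \<open>speed\<close> are positive, as the lemmas about it assume.\<close>

definition angle :: "real \<Rightarrow> real" where "angle t = arccos (outflow t / (rad t * speed))"

text \<open>A bisection argument in place of an enumeration of \<open>C\<close>: as \<open>C\<close>
  is finite, a short interval around \<open>t\<close> contains no point of \<open>C\<close> except
  possibly \<open>t\<close>, and cutting it at \<open>t\<close> leaves two pieces without interior
  kicks.\<close>

lemma path_induct [consumes 3, case_names trans step]:
  assumes "a \<le> s" "s \<le> u" "u \<le> b"
    and trans: "\<And>s t u. \<lbrakk>P s t; P t u; a \<le> s; s \<le> t; t \<le> u; u \<le> b\<rbrakk> \<Longrightarrow> P s u"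
    and step: "\<And>s u. \<lbrakk>a \<le> s; s \<le> u; u \<le> b; C \<inter> {s<..<u} = {}\<rbrakk> \<Longrightarrow> P s u"
  shows "P s u"
proof -
  have "a \<le> s \<and> u \<le> b \<longrightarrow> P s u"
    using \<open>s \<le> u\<close>
  proof (induction rule: Bolzano)
    case (trans s t u)
    then show ?case using assms(4)[of s t u] by auto
  next
    case (local t)
    obtain \<delta> where \<delta>: "\<delta> > 0" "\<And>c. c \<in> C \<Longrightarrow> c \<noteq> t \<Longrightarrow> \<delta> \<le> dist t c"
      using finite_set_avoid[OF finC, of t] by blast
    show ?case
    proof (intro exI[of _ \<delta>] conjI allI impI)
      show "\<delta> > 0" by fact
      fix s u assume su: "s \<le> t \<and> t \<le> u \<and> u - s < \<delta>" "a \<le> s \<and> u \<le> b"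
      have "C \<inter> {s<..<t} = {}" "C \<inter> {t<..<u} = {}"
        using \<delta>(2) su by (force simp: dist_real_def)+
      then have "P s t" "P t u" using step su by auto
      then show "P s u" using trans su by auto
    qed
  qed
  then show ?thesis using assms by auto
qed

lemma speed_eq:
  assumes "a \<le> t" "t \<le> b" shows "L2_set (W t) J = speed"
proof -
  have "L2_set (W t) J = L2_set (W a) J"
    using order_refl assms
  proof (induction rule: path_induct)
    case (step s u)
    then show ?case using energy[OF step] by (simp add: L2_set_def)
  qed simp
  then show ?thesis by (simp add: speed_def)
qed

lemma outflow_mono:
  assumes "a \<le> s" "s \<le> u" "u \<le> b"
  shows "outflow s + speed\<^sup>2 * (u - s) \<le> outflow u"
  using assms
proof (induction rule: path_induct)
  case (trans s t u)
  then show ?case by (simp add: algebra_simps)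
next
  case (step s u)
  have "outflow s + speed\<^sup>2 * (u - s) = outflow s + (\<Sum>i\<in>J. (W s i)\<^sup>2) * (u - s)"
    using speed_eq[of s] step by (simp flip: L2_set_sq)
  also have "\<dots> = (\<Sum>i\<in>J. X s i * W s i + (W s i)\<^sup>2 * (u - s))"
    by (simp add: outflow_def sum.distrib sum_distrib_right)
  also have "\<dots> = (\<Sum>i\<in>J. X u i * W s i)"
  proof (rule sum.cong[OF refl])
    fix i assume "i \<in> J"
    then have "X u i = X s i + (u - s) * W s i" using step free by blast
    show "X s i * W s i + (W s i)\<^sup>2 * (u - s) = X u i * W s i"
      unfolding \<open>X u i = _\<close> by (simp add: algebra_simps power2_eq_square)
  qed
  also have "\<dots> \<le> outflow u" unfolding outflow_def by (rule outward) (use step in auto)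
  finally show ?case .
qed

lemma lipschitz:
  assumes "a \<le> s" "s \<le> u" "u \<le> b"
  shows "L2_set (\<lambda>i. X u i - X s i) J \<le> speed * (u - s)"
  using assms
proof (induction rule: path_induct)
  case (trans s t u)
  then show ?case
    using L2_set_diff_triangle[of "X u" "X s" J "X t"] by (simp add: right_diff_distrib)
next
  case (step s u)
  have "L2_set (\<lambda>i. X u i - X s i) J = L2_set (\<lambda>i. W s i * (u - s)) J"
    by (rule L2_set_cong[OF refl]) (use free[OF step] in simp)
  also have "\<dots> = speed * (u - s)"
    using step speed_eq[of s] L2_set_left_distrib[of "u - s" "W s" J] by simp
  finally show ?case by simp
qed

lemma abs_outflow_le:
  assumes "a \<le> t" "t \<le> b" shows "\<bar>outflow t\<bar> \<le> rad t * speed"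
  using abs_sum_mult_le_L2[of "X t" "W t" J] speed_eq[OF assms] by (simp add: outflow_def rad_def)

lemma rad_lipschitz:
  assumes "a \<le> s" "s \<le> u" "u \<le> b"
  shows "\<bar>rad u - rad s\<bar> \<le> speed * (u - s)"
  using lipschitz[OF assms] L2_set_diff_ge[of "X u" J "X s"] L2_set_diff_ge[of "X s" J "X u"]
    L2_set_minus_commute[of "X u" "X s" J]
  unfolding rad_def by linarith

lemma rad_continuous: "continuous_on {a..b} rad"
proof (rule lipschitz_on_continuous_on)
  show "speed-lipschitz_on {a..b} rad"
  proof (rule lipschitz_onI)
    show "0 \<le> speed" by (simp add: speed_def)
    fix s u assume "s \<in> {a..b}" "u \<in> {a..b}"
    then show "dist (rad s) (rad u) \<le> speed * dist s u"
      using rad_lipschitz[of s u] rad_lipschitz[of u s]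
      by (cases "s \<le> u") (auto simp: dist_real_def abs_minus_commute)
  qed
qed

text \<open>Only the radii at the two ends matter: there the outflow is at most
  \<open>R * speed\<close> in absolute value, and in between it grows at rate at least
  \<open>speed\<close> squared, whether or not the path stays close to the origin.\<close>

lemma small_radius_time:
  assumes "a \<le> s" "s \<le> u" "u \<le> b" "rad s \<le> R" "rad u \<le> R" "speed > 0"
  shows "u - s \<le> 2 * R / speed"
proof -
  have "speed\<^sup>2 * (u - s) \<le> \<bar>outflow u\<bar> + \<bar>outflow s\<bar>" using outflow_mono[OF assms(1-3)] by linarith
  also have "\<dots> \<le> rad u * speed + rad s * speed" using abs_outflow_le assms by (intro add_mono) auto
  also have "\<dots> \<le> R * speed + R * speed" using assms by (intro add_mono mult_right_mono) auto
  finally have "speed * ((u - s) * speed) \<le> speed * (2 * R)" by (simp add: algebra_simps power2_eq_square)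
  then show ?thesis using \<open>speed > 0\<close> by (simp add: pos_le_divide_eq)
qed

text \<open>Both sides are controlled piece by piece, as angles telescope and chords obey the
  triangle inequality. On one piece, \<open>?c\<close> is the cosine of the angle on arrival at
  \<open>u\<close>; the kick raises the outflow at unchanged radius and speed, so it can only lower
  the angle further.\<close>

lemma chord_le_angle_decrease:
  assumes "a \<le> s" "s \<le> u" "u \<le> b" "speed > 0" and pos: "\<And>t. s \<le> t \<Longrightarrow> t \<le> u \<Longrightarrow> rad t > 0"
  shows "L2_set (\<lambda>i. X u i / rad u - X s i / rad s) J \<le> angle s - angle u"
proof -
  have "(\<forall>t\<in>{s..u}. rad t > 0) \<longrightarrow>
      L2_set (\<lambda>i. X u i / rad u - X s i / rad s) J \<le> angle s - angle u"
    using assms(1-3)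
  proof (induction rule: path_induct)
    case (trans s t u)
    then show ?case
      using L2_set_diff_triangle[of "\<lambda>i. X u i / rad u" "\<lambda>i. X s i / rad s" J "\<lambda>i. X t i / rad t"]
      by force
  next
    case (step s u)
    let ?c = "(\<Sum>i\<in>J. X u i * W s i) / (rad u * speed)"
    have sp: "L2_set (W s) J = speed" using speed_eq step by auto
    show ?case
    proof
      assume "\<forall>t\<in>{s..u}. rad t > 0"
      then have pos: "rad s > 0" "rad u > 0" using step by auto
      have "\<And>i. i \<in> J \<Longrightarrow> X u i = X s i + (u - s) * W s i" by (rule free[OF step])
      note chord = chord_le_angle[where X = "X s" and X' = "X u" and w = "W s" and \<tau> = "u - s",
          OF finJ _ this, unfolded sp, folded rad_def, folded outflow_def]
      have c: "outflow s / (rad s * speed) \<le> ?c"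
         "L2_set (\<lambda>i. X u i / rad u - X s i / rad s) J \<le> angle s - arccos ?c"
        unfolding angle_def using chord step pos \<open>speed > 0\<close> by simp_all
      have "?c \<le> outflow u / (rad u * speed)"
        using outward[of s u] step pos \<open>speed > 0\<close>
        by (intro divide_right_mono) (auto simp: outflow_def)
      moreover have "-1 \<le> outflow s / (rad s * speed)" "outflow u / (rad u * speed) \<le> 1"
        using abs_outflow_le[of s] abs_outflow_le[of u] step pos \<open>speed > 0\<close>
        by (auto simp: field_simps abs_le_iff)
      ultimately have "angle u \<le> arccos ?c" unfolding angle_def using c(1)
        by (intro arccos_le_arccos) auto
      with c show "L2_set (\<lambda>i. X u i / rad u - X s i / rad s) J \<le> angle s - angle u" by linarith
    qed
  qed
  then show ?thesis using pos by auto
qed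

lemma angle_antimono:
  assumes "a \<le> s" "s \<le> u" "u \<le> b" "speed > 0" "\<And>t. s \<le> t \<Longrightarrow> t \<le> u \<Longrightarrow> rad t > 0"
  shows "angle u \<le> angle s"
  using order_trans[OF L2_set_nonneg chord_le_angle_decrease[OF assms]] by simp

lemma angle_bounds:
  assumes "a \<le> t" "t \<le> b" "speed > 0" "rad t > 0"
  shows "0 \<le> angle t" "angle t \<le> pi"
proof -
  have "-1 \<le> outflow t / (rad t * speed)" "outflow t / (rad t * speed) \<le> 1"
    using abs_outflow_le[of t] assms by (auto simp: field_simps abs_le_iff)
  then show "0 \<le> angle t" "angle t \<le> pi"
    unfolding angle_def by (auto intro: arccos_lbound arccos_ubound)
qed

end

section \<open>The dynamics\<close>

lemma infinite_less_pair:
  fixes S :: "real set"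
  assumes "infinite S" shows "\<exists>s\<in>S. \<exists>s'\<in>S. s < s'"
proof (rule ccontr)
  assume no: "\<not> ?thesis"
  obtain r where r: "r \<in> S" using infinite_imp_nonempty[OF assms] by blast
  have "S \<subseteq> {r}"
  proof
    fix s assume "s \<in> S"
    then show "s \<in> {r}" using no r by (cases s r rule: linorder_cases) auto
  qed
  then show False using assms finite_subset by blast
qed

locale evolution =
  fixes d n :: nat and x :: motion
  assumes evolution: "hard_ball_evolution d n x"
    and no_simultaneous: "no_simultaneous_collisions d n x"
begin

section \<open>Contacts, free flight and local finiteness of collisions\<close>

lemma continuous_coord:
  assumes "k < n" shows "continuous_on UNIV (\<lambda>t. x k t i)"
proof -
  have "continuous_map euclideanreal (Euclidean_space d) (x k)"
    using evolution assms by (simp add: hard_ball_evolution_def)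
  then have "continuous_map euclideanreal (powertop_real UNIV) (x k)"
    by (simp add: Euclidean_space_def continuous_map_in_subtopology)
  then show ?thesis by (simp add: continuous_map_componentwise_UNIV)
qed

lemma continuous_dist:
  assumes "j < n" "k < n" shows "continuous_on UNIV (\<lambda>t. dist_d d (x j t) (x k t))"
  unfolding dist_d_def L2_set_def
  by (intro continuous_intros continuous_coord assms)

lemma dist_d_commute: "dist_d d u w = dist_d d w u"
  unfolding dist_d_def by (rule L2_set_minus_commute)

lemma touch_sym: "touch d n x t j k \<Longrightarrow> touch d n x t k j"
  by (auto simp: touch_def dist_d_commute)

lemma collide_sym: "collide d n x j k t \<Longrightarrow> collide d n x k j t"
  by (auto simp: collide_def touch_sym)

lemma collide_touch: "collide d n x j k t \<Longrightarrow> touch d n x t j k"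
  by (auto simp: collide_def)

text \<open>Otherwise \<open>j\<close>, \<open>k\<close> and \<open>l\<close> would be a chain
  through \<open>k\<close> of three balls in contact. Hence the contacts at any instant form a
  matching.\<close>

lemma touch_unique:
  assumes "touch d n x t j k" "touch d n x t l k" shows "j = l"
proof (rule ccontr)
  assume "j \<noteq> l"
  have lt: "j < n" "k < n" "l < n" and ne: "j \<noteq> k" "l \<noteq> k"
    using assms by (auto simp: touch_def)
  have "(touch d n x t)\<^sup>*\<^sup>* p q" if "p \<in> {j, k, l}" "q \<in> {j, k, l}" for p q
  proof -
    have "(touch d n x t)\<^sup>*\<^sup>* p k" "(touch d n x t)\<^sup>*\<^sup>* k q"
      using that assms touch_sym by (blast intro: r_into_rtranclp)+
    then show ?thesis by (rule rtranclp_trans)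
  qed
  moreover have "card {j, k, l} = 3" using ne \<open>j \<noteq> l\<close> by auto
  moreover have "{j, k, l} \<subseteq> {..<n}" using lt by auto
  ultimately show False
    using no_simultaneous unfolding no_simultaneous_collisions_def by (metis order_refl)
qed

text \<open>The dynamics gives a constant derivative only inside the interval. Continuity carries
  the affine formula to both ends, where the one-sided derivatives can then be read off, even if the
  ball collides there.\<close>

lemma no_collision_flight:
  assumes k: "k < n" and su: "s < u"
    and free: "\<And>t j. s < t \<Longrightarrow> t < u \<Longrightarrow> \<not> collide d n x j k t"
  shows "s \<le> t \<Longrightarrow> t \<le> u \<Longrightarrow> x k t i = x k s i + (t - s) * vel_after x k s i"
    and "vel_before x k u = vel_after x k s"
proof -
  obtain v where v: "\<And>t i. s < t \<Longrightarrow> t < u \<Longrightarrow> ((\<lambda>r. x k r i) has_real_derivative v i) (at t)"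
    using evolution k free unfolding hard_ball_evolution_def
    by (metis greaterThanLessThan_iff)
  have lin: "x k t i = x k s i + (t - s) * v i" if "s \<le> t" "t \<le> u" for t i
  proof -
    have "x k t i - t * v i = x k s i - s * v i"
    proof (rule DERIV_isconst2[OF su])
      show "continuous_on {s..u} (\<lambda>t. x k t i - t * v i)"
        by (intro continuous_intros continuous_on_subset[OF continuous_coord[OF k]]) auto
      fix r assume "s < r" "r < u"
      then show "((\<lambda>t. x k t i - t * v i) has_real_derivative 0) (at r)"
        using v by (auto intro!: derivative_eq_intros)
    qed (use that in auto)
    then show ?thesis by (simp add: algebra_simps)
  qed
  have lin_deriv: "((\<lambda>t. x k s i + (t - s) * v i) has_vector_derivative v i) (at r within S)" for r S i
    by (auto intro!: derivative_eq_intros simp flip: has_real_derivative_iff_has_vector_derivative)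
  have deriv: "((\<lambda>t. x k t i) has_vector_derivative v i) (at r within {s..u})" if "r \<in> {s..u}" for r i
    by (rule has_vector_derivative_transform[OF that _ lin_deriv[of i r "{s..u}"]]) (rule lin; simp)
  have va: "vel_after x k s = v"
    unfolding vel_after_def using deriv[of s] su
    by (intro ext vector_derivative_within) (auto simp: at_within_Icc_at_right)
  have vb: "vel_before x k u = v"
    unfolding vel_before_def using deriv[of u] su
    by (intro ext vector_derivative_within) (auto simp: at_within_Icc_at_left)
  show "s \<le> t \<Longrightarrow> t \<le> u \<Longrightarrow> x k t i = x k s i + (t - s) * vel_after x k s i"
    unfolding va by (rule lin)
  show "vel_before x k u = vel_after x k s" by (simp add: va vb)
qed

text \<open>A normal form of the elastic law: \<open>e\<close> is the unit vector from the centre of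
  \<open>k\<close> to that of \<open>j\<close>, and \<open>c\<close> is the speed of approach along
  it, positive by the sign condition on incoming velocities.\<close>

lemma collision_jump:
  assumes "collide d n x j k t"
  shows "\<exists>c>0. \<exists>e.
    (\<forall>i. vel_after x j t i = vel_before x j t i + c * e i) \<and>
    (\<forall>i. vel_after x k t i = vel_before x k t i - c * e i) \<and>
    (\<forall>i. x j t i - x k t i = 2 * e i) \<and> (\<Sum>i<d. (e i)\<^sup>2) = 1 \<and>
    (\<Sum>i<d. (vel_before x j t i - vel_before x k t i) * e i) = - c"
proof -
  define e where "e = unit_normal d x j k t"
  define vj where "vj = vel_before x j t"
  define vk where "vk = vel_before x k t"
  define c where "c = inner_d d vk e - inner_d d vj e"
  have D: "dist_d d (x j t) (x k t) = 2" using assms by (simp add: collide_def touch_def)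
  have e: "x j t i - x k t i = 2 * e i" for i
    by (simp add: e_def unit_normal_def D)
  have "elastic_law d x j k t" using assms evolution by (simp add: hard_ball_evolution_def)
  then have law: "inner_d d (\<lambda>i. vj i - vk i) (\<lambda>i. x j t i - x k t i) < 0"
    "vel_after x j t = (\<lambda>i. vj i + inner_d d vk e * e i - inner_d d vj e * e i)"
    "vel_after x k t = (\<lambda>i. vk i + inner_d d vj e * e i - inner_d d vk e * e i)"
    unfolding elastic_law_def Let_def e_def vj_def vk_def by auto
  have c: "c = - (\<Sum>i<d. (vj i - vk i) * e i)"
    by (simp add: c_def inner_d_def left_diff_distrib sum_subtractf)
  show ?thesis
  proof (intro exI[of _ c] exI[of _ e] conjI allI)
    show "c > 0" using law(1) unfolding c inner_d_def e
      by (simp add: mult.left_commute flip: sum_distrib_left)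
    show "vel_after x j t i = vel_before x j t i + c * e i" for i
      using law(2) by (simp add: c_def vj_def left_diff_distrib)
    show "vel_after x k t i = vel_before x k t i - c * e i" for i
      using law(3) by (simp add: c_def vk_def left_diff_distrib)
    show "x j t i - x k t i = 2 * e i" for i by (rule e)
    have "(dist_d d (x j t) (x k t))\<^sup>2 = 4 * (\<Sum>i<d. (e i)\<^sup>2)"
      unfolding dist_d_def L2_set_sq e by (simp add: power_mult_distrib sum_distrib_left)
    then show "(\<Sum>i<d. (e i)\<^sup>2) = 1" by (simp add: D)
    show "(\<Sum>i<d. (vel_before x j t i - vel_before x k t i) * e i) = - c"
      using c by (simp add: vj_def vk_def)
  qed
qed

text \<open>The normal component of the relative velocity is reversed, from \<open>- c\<close> to
  \<open>c\<close>, and the centres differ by \<open>2 e\<close>, so the sum is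
  \<open>2 c\<close>.\<close>

lemma separating_after_collision:
  assumes "collide d n x j k t"
  shows "(\<Sum>i<d. (x j t i - x k t i) * (vel_after x j t i - vel_after x k t i)) > 0"
proof -
  obtain c e where ce: "c > 0" "\<And>i. vel_after x j t i = vel_before x j t i + c * e i"
    "\<And>i. vel_after x k t i = vel_before x k t i - c * e i" "\<And>i. x j t i - x k t i = 2 * e i"
    "(\<Sum>i<d. (e i)\<^sup>2) = 1" "(\<Sum>i<d. (vel_before x j t i - vel_before x k t i) * e i) = - c"
    using collision_jump[OF assms] by blast
  have "(\<Sum>i<d. (x j t i - x k t i) * (vel_after x j t i - vel_after x k t i))
      = 2 * (\<Sum>i<d. (vel_before x j t i - vel_before x k t i) * e i) + 4 * c * (\<Sum>i<d. (e i)\<^sup>2)"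
    unfolding ce(4) unfolding ce(2,3) sum_distrib_left sum.distrib[symmetric]
    by (rule sum.cong) (auto simp: algebra_simps power2_eq_square)
  then show ?thesis using ce(1,5,6) by simp
qed

text \<open>The squared distance \<open>q\<close> has a positive right derivative at
  \<open>t\<close>, hence exceeds 4 shortly afterwards.\<close>

lemma no_touch_just_after_collision:
  assumes coll: "collide d n x j k t"
  obtains \<delta> where "\<delta> > 0" "\<And>s. t < s \<Longrightarrow> s < t + \<delta> \<Longrightarrow> \<not> touch d n x s j k"
proof -
  define q where "q s = (\<Sum>i<d. (x j s i - x k s i)\<^sup>2)" for s
  have lt: "j < n" "k < n" and D: "dist_d d (x j t) (x k t) = 2"
    using coll by (auto simp: collide_def touch_def)
  have vd: "((\<lambda>s. x l s i) has_real_derivative vel_after x l t i) (at_right t)" if "l < n" for l i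
    using evolution that unfolding hard_ball_evolution_def vel_after_def
    by (auto simp: has_real_derivative_iff_has_vector_derivative simp flip: vector_derivative_works)
  have "(q has_real_derivative
      (\<Sum>i<d. 2 * (x j t i - x k t i) * (vel_after x j t i - vel_after x k t i))) (at_right t)"
    unfolding q_def using vd[OF lt(1)] vd[OF lt(2)]
    by (auto intro!: derivative_eq_intros sum.cong)
  moreover have "(\<Sum>i<d. 2 * (x j t i - x k t i) * (vel_after x j t i - vel_after x k t i)) > 0"
    using separating_after_collision[OF coll] by (simp only: mult.assoc flip: sum_distrib_left)
  ultimately obtain \<delta> where \<delta>: "\<delta> > 0" "\<And>h. 0 < h \<Longrightarrow> t + h \<in> {t<..} \<Longrightarrow> h < \<delta> \<Longrightarrow> q t < q (t + h)"
    using has_real_derivative_pos_inc_right by blast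
  show thesis
  proof (rule that[OF \<delta>(1)])
    fix s assume "t < s" "s < t + \<delta>"
    then have "q t < q s" using \<delta>(2)[of "s - t"] by simp
    moreover have "q s = (dist_d d (x j s) (x k s))\<^sup>2" for s
      unfolding q_def dist_d_def L2_set_sq ..
    ultimately show "\<not> touch d n x s j k" using D by (auto simp: touch_def)
  qed
qed

text \<open>Until their next collision the two balls fly freely with separating velocities, so the
  squared distance is a quadratic in time with positive linear and nonnegative leading coefficient,
  and it cannot return to 4.\<close>

lemma isolated_pair_collides_once:
  assumes s: "collide d n x j k s" and s': "collide d n x j k s'" and "s < s'"
    and iso: "\<And>t l. s < t \<Longrightarrow> t < s' \<Longrightarrow> collide d n x l j t \<Longrightarrow> l = k"
             "\<And>t l. s < t \<Longrightarrow> t < s' \<Longrightarrow> collide d n x l k t \<Longrightarrow> l = j"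
  shows False
proof -
  obtain \<delta> where \<delta>: "\<delta> > 0" "\<And>t. s < t \<Longrightarrow> t < s + \<delta> \<Longrightarrow> \<not> touch d n x t j k"
    using no_touch_just_after_collision[OF s] by blast
  have lt: "j < n" "k < n" and Ds: "dist_d d (x j s) (x k s) = 2"
    using s by (auto simp: collide_def touch_def)
  define T where "T = {t. s < t \<and> t \<le> s' \<and> collide d n x j k t}"
  \<comment> \<open>By the choice of \<open>\<delta>\<close> the infimum lies strictly after
    \<open>s\<close>. It need not be a collision time itself, but as a limit of contacts it is a
    contact, and this is enough.\<close>
  define b where "b = Inf T"
  have T: "s' \<in> T" "bdd_below T" "T \<noteq> {}"
    using s' \<open>s < s'\<close> by (auto simp: T_def intro: bdd_belowI[of _ s])
  have "s + \<delta> \<le> b"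
    unfolding b_def
  proof (rule cInf_greatest[OF T(3)])
    fix t assume "t \<in> T"
    then show "s + \<delta> \<le> t" using \<delta>(2)[of t] collide_touch by (force simp: T_def)
  qed
  then have sb: "s < b" using \<delta>(1) by simp
  have bs': "b \<le> s'" unfolding b_def using T by (intro cInf_lower) auto
  have no: "\<not> collide d n x j k t" if "s < t" "t < b" for t
    using that bs' cInf_lower[OF _ T(2), of t] by (force simp: T_def b_def)
  have "b \<in> closure T" unfolding b_def using T by (intro closure_contains_Inf)
  moreover have "closed {t. dist_d d (x j t) (x k t) = 2}"
    by (intro closed_Collect_eq continuous_dist lt continuous_on_const)
  then have "closure T \<subseteq> {t. dist_d d (x j t) (x k t) = 2}"
    by (rule closure_minimal[rotated]) (auto simp: T_def collide_def touch_def)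
  ultimately have Db: "dist_d d (x j b) (x k b) = 2" by auto
  have free: "x l b i = x l s i + (b - s) * vel_after x l s i" if "l \<in> {j, k}" for l i
  proof (rule no_collision_flight(1)[OF _ sb])
    fix t m assume "s < t" "t < b"
    show "\<not> collide d n x m l t"
    proof
      assume *: "collide d n x m l t"
      have "t < s'" using \<open>t < b\<close> bs' by simp
      have "collide d n x j k t"
      proof (cases "l = j")
        case True
        then have "m = k" using iso(1)[OF \<open>s < t\<close> \<open>t < s'\<close>] * by blast
        then show ?thesis using * True collide_sym by blast
      next
        case False
        then have "l = k" using that by blast
        then have "m = j" using iso(2)[OF \<open>s < t\<close> \<open>t < s'\<close>] * by blast
        then show ?thesis using * \<open>l = k\<close> by blast
      qed
      then show False using no[OF \<open>s < t\<close> \<open>t < b\<close>] by blast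
    qed
  qed (use that lt sb in auto)
  define y where "y i = x j s i - x k s i" for i
  define w where "w i = vel_after x j s i - vel_after x k s i" for i
  have "(dist_d d (x j b) (x k b))\<^sup>2 = (\<Sum>i<d. (y i + (b - s) * w i)\<^sup>2)"
    unfolding dist_d_def L2_set_sq by (simp add: free y_def w_def algebra_simps)
  also have "\<dots> = (\<Sum>i<d. (y i)\<^sup>2) + 2 * (b - s) * (\<Sum>i<d. y i * w i) + (b - s)\<^sup>2 * (\<Sum>i<d. (w i)\<^sup>2)"
    unfolding sum_distrib_left sum.distrib[symmetric]
    by (rule sum.cong) (auto simp: power2_sum power_mult_distrib mult_ac)
  also have "(\<Sum>i<d. (y i)\<^sup>2) = (dist_d d (x j s) (x k s))\<^sup>2"
    unfolding dist_d_def L2_set_sq by (simp add: y_def)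
  finally have "2 * (b - s) * (\<Sum>i<d. y i * w i) + (b - s)\<^sup>2 * (\<Sum>i<d. (w i)\<^sup>2) = 0"
    by (simp add: Ds Db)
  moreover have "(\<Sum>i<d. y i * w i) > 0"
    using separating_after_collision[OF s] by (simp add: y_def w_def)
  then have "2 * (b - s) * (\<Sum>i<d. y i * w i) > 0" using sb by simp
  moreover have "(b - s)\<^sup>2 * (\<Sum>i<d. (w i)\<^sup>2) \<ge> 0" by (simp add: sum_nonneg)
  ultimately show False by linarith
qed

text \<open>Local finiteness has to be derived from the ban on multiple contacts. Infinitely many
  collisions would make the collision times of one pair accumulate at some \<open>t\<close>, where
  the pair is in contact by continuity. No third ball touches either of them at \<open>t\<close>,
  hence none does near \<open>t\<close>, and there the pair can collide only once.\<close>

lemma finite_collisions: "finite {(j, k, t) \<in> collisions d n x. t \<in> {a..b}}"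
proof (rule ccontr)
  assume inf: "\<not> finite {(j, k, t) \<in> collisions d n x. t \<in> {a..b}}"
  define T where "T j k = {t \<in> {a..b}. collide d n x j k t}" for j k
  have sub: "{(j, k, t) \<in> collisions d n x. t \<in> {a..b}} \<subseteq> (\<Union>j<n. \<Union>k<n. (\<lambda>t. (j, k, t)) ` T j k)"
    by (auto simp: collisions_def T_def collide_def touch_def)
  have "\<exists>j<n. \<exists>k<n. infinite (T j k)"
  proof (rule ccontr)
    assume "\<not> ?thesis"
    then have "finite (\<Union>j<n. \<Union>k<n. (\<lambda>t. (j, k, t)) ` T j k)"
      by (intro finite_UN_I finite_imageI finite_lessThan) auto
    then show False using inf sub finite_subset by blast
  qed
  then obtain j k where lt: "j < n" "k < n" and infT: "infinite (T j k)" by blast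
  have "T j k \<subseteq> {a..b}" by (auto simp: T_def)
  then obtain t where t: "t islimpt T j k"
    using Heine_Borel_imp_Bolzano_Weierstrass[OF compact_Icc infT] by blast
  have "closed {t. dist_d d (x j t) (x k t) = 2}"
    by (intro closed_Collect_eq continuous_dist lt continuous_on_const)
  then have "t \<in> {t. dist_d d (x j t) (x k t) = 2}"
    using islimpt_subset[OF t, of "{t. dist_d d (x j t) (x k t) = 2}"]
    by (auto simp: closed_limpt T_def collide_def touch_def)
  moreover have "T j k \<noteq> {}" using infT by auto
  then have "j \<noteq> k" by (auto simp: T_def collide_def touch_def)
  ultimately have tjk: "touch d n x t j k" using lt by (simp add: touch_def)
  have ev: "\<forall>\<^sub>F s in nhds t. dist_d d (x l s) (x m s) \<noteq> 2"
    if "l < n" "l \<noteq> j" "l \<noteq> k" "m \<in> {j, k}" for l m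
  proof -
    have m: "m < n" using that lt by auto
    have "dist_d d (x l t) (x m t) \<noteq> 2"
    proof
      assume "dist_d d (x l t) (x m t) = 2"
      then have "touch d n x t l m" using that m by (auto simp: touch_def)
      then show False
        using touch_unique[of t l m k] touch_unique[of t l m j] tjk touch_sym[OF tjk] that by auto
    qed
    moreover have "open {t. dist_d d (x l t) (x m t) \<noteq> 2}"
      by (intro open_Collect_neq continuous_dist m that continuous_on_const)
    ultimately show ?thesis by (auto simp: eventually_nhds)
  qed
  then have "\<forall>\<^sub>F s in nhds t. \<forall>l\<in>{..<n} - {j, k}. \<forall>m\<in>{j, k}. dist_d d (x l s) (x m s) \<noteq> 2"
    by (intro eventually_ball_finite ballI ev) auto
  then obtain \<delta> where \<delta>: "\<delta> > 0" "\<And>s l m. dist s t < \<delta> \<Longrightarrow> l \<in> {..<n} - {j, k} \<Longrightarrow> m \<in> {j, k} \<Longrightarrow>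
      dist_d d (x l s) (x m s) \<noteq> 2"
    unfolding eventually_nhds_metric by blast
  have "infinite (T j k \<inter> ball t \<delta>)" using t \<delta>(1) by (simp add: islimpt_eq_infinite_ball)
  then obtain s s' where "s \<in> T j k \<inter> ball t \<delta>" "s' \<in> T j k \<inter> ball t \<delta>" "s < s'"
    using infinite_less_pair by blast
  then have ss: "collide d n x j k s" "collide d n x j k s'" "s < s'" "\<bar>s - t\<bar> < \<delta>" "\<bar>s' - t\<bar> < \<delta>"
    by (auto simp: T_def dist_real_def abs_minus_commute)
  have no: "l = j \<or> l = k" if "s < r" "r < s'" "collide d n x l m r" "m \<in> {j, k}" for r l m
  proof (rule ccontr)
    assume "\<not> (l = j \<or> l = k)"
    moreover have "dist r t < \<delta>" using ss that by (auto simp: dist_real_def)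
    ultimately show False using \<delta>(2)[of r l m] that by (auto simp: collide_def touch_def)
  qed
  show False
  proof (rule isolated_pair_collides_once[OF ss(1-3)])
    fix r l assume "s < r" "r < s'"
    show "l = k" if "collide d n x l j r"
      using no[OF \<open>s < r\<close> \<open>r < s'\<close> that] that by (auto simp: collide_def touch_def)
    show "l = j" if "collide d n x l k r"
      using no[OF \<open>s < r\<close> \<open>r < s'\<close> that] that by (auto simp: collide_def touch_def)
  qed
qed

text \<open>Only collisions with outside balls are excluded. A contact that leaves the velocities
  unchanged is allowed, as it does not affect the conservation laws.\<close>

definition isolated :: "nat set \<Rightarrow> real \<Rightarrow> bool" where
  "isolated A t \<longleftrightarrow> (\<forall>j\<in>A. \<forall>k. k \<notin> A \<longrightarrow> \<not> collide d n x j k t)"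

text \<open>Every ball takes part in at most one collision at time \<open>t\<close>, so a sum over an isolated
  family can be rearranged along the involution exchanging collision partners.\<close>

lemma sum_nonneg_if_collision_pairs:
  fixes g :: "nat \<Rightarrow> real"
  assumes A: "A \<subseteq> {..<n}" and iso: "isolated A t"
    and pair: "\<And>j k. collide d n x j k t \<Longrightarrow> 0 \<le> g j + g k"
    and alone: "\<And>k. k \<in> A \<Longrightarrow> vel_after x k t = vel_before x k t \<Longrightarrow> 0 \<le> g k"
  shows "0 \<le> sum g A"
proof -
  define p where "p k = (if \<exists>j. collide d n x j k t then SOME j. collide d n x j k t else k)" for k
  have p_eq: "p k = j" if "collide d n x j k t" for j k
  proof -
    have "collide d n x (p k) k t" unfolding p_def using that by (auto intro: someI)
    then show ?thesis using that touch_unique collide_touch by blast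
  qed
  have pp: "p k \<in> A \<and> p (p k) = k" if "k \<in> A" for k
  proof (cases "\<exists>j. collide d n x j k t")
    case True
    then obtain j where j: "collide d n x j k t" by blast
    then have "p k = j" "p j = k" using p_eq collide_sym by blast+
    moreover have "j \<in> A" using iso j collide_sym that unfolding isolated_def by blast
    ultimately show ?thesis by simp
  next
    case False
    then show ?thesis using that by (simp add: p_def)
  qed
  have "bij_betw p A A" by (rule bij_betw_byWitness[where f' = p]) (use pp in auto)
  then have "sum g A = (\<Sum>k\<in>A. g (p k))" by (simp add: sum.reindex_bij_betw)
  then have "2 * sum g A = (\<Sum>k\<in>A. g k + g (p k))" by (simp add: sum.distrib)
  also have "\<dots> \<ge> 0"
  proof (rule sum_nonneg)
    fix k assume k: "k \<in> A"
    show "0 \<le> g k + g (p k)"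
    proof (cases "\<exists>j. collide d n x j k t")
      case True
      then obtain j where j: "collide d n x j k t" by blast
      then show ?thesis using p_eq[OF j] pair[OF j] by simp
    next
      case False
      have "k < n" using A k by auto
      then have "vel_after x k t = vel_before x k t"
        using False evolution unfolding hard_ball_evolution_def by metis
      then show ?thesis using alone[OF k] False by (simp add: p_def)
    qed
  qed
  finally show ?thesis by simp
qed

section \<open>Conservation laws and outward kicks of an isolated family\<close>

lemma momentum_conserved:
  assumes "A \<subseteq> {..<n}" "isolated A t"
  shows "(\<Sum>k\<in>A. vel_after x k t i) = (\<Sum>k\<in>A. vel_before x k t i)"
proof -
  have pair: "vel_after x j t i - vel_before x j t i + (vel_after x k t i - vel_before x k t i) = 0"
    if coll: "collide d n x j k t" for j k
  proof -
    obtain c e where "vel_after x j t i = vel_before x j t i + c * e i"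
      "vel_after x k t i = vel_before x k t i - c * e i"
      using collision_jump[OF coll] by blast
    then show ?thesis by simp
  qed
  have "0 \<le> (\<Sum>k\<in>A. vel_after x k t i - vel_before x k t i)"
    by (rule sum_nonneg_if_collision_pairs[OF assms]) (use pair in auto)
  \<comment> \<open>Equality comes from using the inequality for pairs with both signs.\<close>
  moreover have "0 \<le> (\<Sum>k\<in>A. vel_before x k t i - vel_after x k t i)"
  proof (rule sum_nonneg_if_collision_pairs[OF assms])
    show "0 \<le> vel_before x j t i - vel_after x j t i + (vel_before x k t i - vel_after x k t i)"
      if "collide d n x j k t" for j k
      using pair[OF that] by linarith
  qed simp
  ultimately show ?thesis by (simp add: sum_subtractf)
qed

lemma energy_conserved:
  assumes "A \<subseteq> {..<n}" "isolated A t"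
  shows "(\<Sum>k\<in>A. \<Sum>i<d. (vel_after x k t i)\<^sup>2) = (\<Sum>k\<in>A. \<Sum>i<d. (vel_before x k t i)\<^sup>2)"
proof -
  define g where "g k = (\<Sum>i<d. (vel_after x k t i)\<^sup>2) - (\<Sum>i<d. (vel_before x k t i)\<^sup>2)" for k
  have pair: "g j + g k = 0" if coll: "collide d n x j k t" for j k
  proof -
    obtain c e where ce: "c > 0" "\<And>i. vel_after x j t i = vel_before x j t i + c * e i"
      "\<And>i. vel_after x k t i = vel_before x k t i - c * e i" "\<And>i. x j t i - x k t i = 2 * e i"
      "(\<Sum>i<d. (e i)\<^sup>2) = 1" "(\<Sum>i<d. (vel_before x j t i - vel_before x k t i) * e i) = - c"
      using collision_jump[OF coll] by blast
    have "g j + g k = 2 * c * (\<Sum>i<d. (vel_before x j t i - vel_before x k t i) * e i)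
        + 2 * c\<^sup>2 * (\<Sum>i<d. (e i)\<^sup>2)"
      unfolding g_def ce(2,3) sum_distrib_left sum.distrib[symmetric] sum_subtractf[symmetric]
      by (rule sum.cong) (auto simp: algebra_simps power2_eq_square)
    then show ?thesis using ce(5,6) by (simp add: power2_eq_square)
  qed
  have "0 \<le> sum g A"
    by (rule sum_nonneg_if_collision_pairs[OF assms]) (use pair in \<open>auto simp: g_def\<close>)
  moreover have "0 \<le> (\<Sum>k\<in>A. - g k)"
  proof (rule sum_nonneg_if_collision_pairs[OF assms])
    show "0 \<le> - g j + - g k" if "collide d n x j k t" for j k using pair[OF that] by simp
  qed (simp add: g_def)
  ultimately have "sum g A = 0" by (simp add: sum_negf)
  then show ?thesis by (simp add: g_def sum_subtractf)
qed

text \<open>A colliding pair contributes the impulse \<open>c e\<close> paired with the difference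
  \<open>2 e\<close> of the centres, which is \<open>2 c > 0\<close>: collisions push apart along
  the line of centres.\<close>

lemma outward_increases:
  assumes "A \<subseteq> {..<n}" "isolated A t"
  shows "(\<Sum>k\<in>A. \<Sum>i<d. x k t i * vel_before x k t i) \<le> (\<Sum>k\<in>A. \<Sum>i<d. x k t i * vel_after x k t i)"
proof -
  define g where "g k = (\<Sum>i<d. x k t i * vel_after x k t i) - (\<Sum>i<d. x k t i * vel_before x k t i)" for k
  have pair: "0 \<le> g j + g k" if coll: "collide d n x j k t" for j k
  proof -
    obtain c e where ce: "c > 0" "\<And>i. vel_after x j t i = vel_before x j t i + c * e i"
      "\<And>i. vel_after x k t i = vel_before x k t i - c * e i" "\<And>i. x j t i - x k t i = 2 * e i"
      "(\<Sum>i<d. (e i)\<^sup>2) = 1" "(\<Sum>i<d. (vel_before x j t i - vel_before x k t i) * e i) = - c"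
      using collision_jump[OF coll] by blast
    have "g j + g k = (\<Sum>i<d. c * e i * (x j t i - x k t i))"
      unfolding g_def ce(2,3) sum.distrib[symmetric] sum_subtractf[symmetric]
      by (rule sum.cong) (auto simp: algebra_simps)
    also have "\<dots> = 2 * c * (\<Sum>i<d. (e i)\<^sup>2)"
      unfolding ce(4) sum_distrib_left by (rule sum.cong) (auto simp: power2_eq_square)
    finally show ?thesis using ce(1,5) by simp
  qed
  have "0 \<le> sum g A"
    by (rule sum_nonneg_if_collision_pairs[OF assms]) (use pair in \<open>auto simp: g_def\<close>)
  then show ?thesis by (simp add: g_def sum_subtractf)
qed

end

section \<open>Splitting a configuration at a gap\<close>

lemma card_le_fibres:
  assumes S: "finite S" and I: "finite I" "\<And>s. s \<in> S \<Longrightarrow> \<phi> s \<in> I"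
    and le: "\<And>i. i \<in> I \<Longrightarrow> real (card {s \<in> S. \<phi> s = i}) \<le> M"
  shows "real (card S) \<le> real (card I) * M"
proof -
  have "S = (\<Union>i\<in>I. {s \<in> S. \<phi> s = i})" using I by auto
  then have "card S \<le> (\<Sum>i\<in>I. card {s \<in> S. \<phi> s = i})"
    using card_UN_le[OF I(1), of "\<lambda>i. {s \<in> S. \<phi> s = i}"] by simp
  then have "real (card S) \<le> (\<Sum>i\<in>I. real (card {s \<in> S. \<phi> s = i}))"
    by (simp flip: of_nat_sum)
  also have "\<dots> \<le> real (card I) * M" using le by (rule sum_bounded_above)
  finally show ?thesis .
qed

text \<open>The covariance identity. It shows that passing to the centre of mass changes energy and
  outflow only by terms in the total sums over the family.\<close>

lemma sum_centered_mult:
  fixes p q :: "'a \<Rightarrow> real"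
  assumes "finite A" "A \<noteq> {}"
  shows "(\<Sum>k\<in>A. (p k - sum p A / card A) * (q k - sum q A / card A))
    = (\<Sum>k\<in>A. p k * q k) - sum p A * sum q A / card A"
proof -
  have m: "real (card A) > 0" using assms by (simp add: card_gt_0_iff)
  have "(\<Sum>k\<in>A. (p k - sum p A / card A) * (q k - sum q A / card A))
     = (\<Sum>k\<in>A. p k * q k - sum q A / card A * p k - sum p A / card A * q k
         + sum p A / card A * (sum q A / card A))"
    by (rule sum.cong) (auto simp: algebra_simps)
  also have "\<dots> = (\<Sum>k\<in>A. p k * q k) - sum q A / card A * sum p A - sum p A / card A * sum q A
      + real (card A) * (sum p A / card A * (sum q A / card A))"
    by (simp add: sum.distrib sum_subtractf sum_distrib_left)
  also have "\<dots> = (\<Sum>k\<in>A. p k * q k) - sum p A * sum q A / card A"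
    using m by (simp add: field_simps)
  finally show ?thesis .
qed

lemma dist_d_triangle: "dist_d d u w \<le> dist_d d u v + dist_d d v w"
  unfolding dist_d_def by (rule L2_set_diff_triangle)

lemma dist_d_nonneg: "0 \<le> dist_d d u w"
  by (simp add: dist_d_def)

text \<open>The distances to a fixed point of the family take few values, so by pigeonhole they avoid one
  of the slots that cut the distance to a far point into equal parts.\<close>

lemma split_by_gap:
  fixes y :: "nat \<Rightarrow> point"
  assumes A: "finite A" and center: "\<And>i. i < d \<Longrightarrow> (\<Sum>k\<in>A. y k i) = 0"
    and r: "r > 0" "(\<Sum>k\<in>A. \<Sum>i<d. (y k i)\<^sup>2) = r\<^sup>2"
  obtains A1 where "A1 \<subset> A" "A1 \<noteq> {}"
    "\<And>j k. j \<in> A1 \<Longrightarrow> k \<in> A - A1 \<Longrightarrow> r / (real (card A) * sqrt (card A)) \<le> dist_d d (y j) (y k)"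
proof -
  define m where "m = card A"
  have "A \<noteq> {}" using r by auto
  then obtain p where p: "p \<in> A" by blast
  have m: "m > 0" using A p by (auto simp: m_def card_gt_0_iff)
  define h where "h k = dist_d d (y k) (y p)" for k
  define g where "g = r / (real m * sqrt m)"
  have g: "g > 0" using r m by (simp add: g_def)
  \<comment> \<open>The parallel axis theorem: for a centred configuration the squared distances to
    \<open>p\<close> sum to \<open>r^2 + m |y p|^2\<close>. Hence some ball \<open>q\<close> is at
    distance at least \<open>r / sqrt m\<close> from \<open>p\<close>, which is \<open>m\<close>
    slots of width \<open>g\<close>.\<close>
  have "(\<Sum>k\<in>A. (h k)\<^sup>2) = (\<Sum>k\<in>A. \<Sum>i<d. (y k i)\<^sup>2 - 2 * y p i * y k i + (y p i)\<^sup>2)"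
    unfolding h_def dist_d_def L2_set_sq by (intro sum.cong) (auto simp: power2_diff)
  also have "\<dots> = r\<^sup>2 - (\<Sum>i<d. 2 * y p i * (\<Sum>k\<in>A. y k i)) + real m * (\<Sum>i<d. (y p i)\<^sup>2)"
    unfolding r(2)[symmetric] m_def sum_distrib_left
    by (subst (3) sum.swap) (simp add: sum.distrib sum_subtractf sum_distrib_left)
  also have "(\<Sum>i<d. 2 * y p i * (\<Sum>k\<in>A. y k i)) = 0" using center by simp
  finally have "r\<^sup>2 \<le> (\<Sum>k\<in>A. (h k)\<^sup>2)" by (simp add: sum_nonneg)
  have "\<exists>q\<in>A. r\<^sup>2 / real m \<le> (h q)\<^sup>2"
  proof (rule ccontr)
    assume "\<not> ?thesis"
    then have "(\<Sum>k\<in>A. (h k)\<^sup>2) < (\<Sum>k\<in>A. r\<^sup>2 / real m)"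
      using A \<open>A \<noteq> {}\<close> by (intro sum_strict_mono) auto
    also have "\<dots> = r\<^sup>2" using m by (simp add: m_def)
    finally show False using \<open>r\<^sup>2 \<le> _\<close> by simp
  qed
  then obtain q where q: "q \<in> A" "r\<^sup>2 / real m \<le> (h q)\<^sup>2" by blast
  have h0: "0 \<le> h k" for k by (simp add: h_def dist_d_nonneg)
  have "real m * g = r / sqrt m" using m by (simp add: g_def)
  also have "\<dots> \<le> h q"
    by (rule power2_le_imp_le) (use q(2) m h0 in \<open>auto simp: power_divide\<close>)
  finally have hq: "real m * g \<le> h q" .
  define \<phi> where "\<phi> k = nat \<lfloor>h k / g\<rfloor>" for k
  \<comment> \<open>Without \<open>p\<close> there are only \<open>m - 1\<close> balls for
    \<open>m\<close> slots, so slot \<open>i\<close> is empty. If \<open>i = 0\<close>, then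
    \<open>p\<close> itself lies at its lower end, which does no harm to the gap.\<close>
  have "card (\<phi> ` (A - {p})) \<le> card (A - {p})" using A by (intro card_image_le) auto
  also have "\<dots> < card {..<m}" using A p m by (simp add: m_def)
  finally have "\<not> {..<m} \<subseteq> \<phi> ` (A - {p})"
    using A by (meson card_mono finite_Diff finite_imageI not_less)
  then obtain i where i: "i < m" "i \<notin> \<phi> ` (A - {p})" by auto
  define A1 where "A1 = {k \<in> A. h k < (real i + 1) * g}"
  show thesis
  proof (rule that)
    have "(real i + 1) * g \<le> real m * g" using i g by (intro mult_right_mono) auto
    then have "q \<notin> A1" using hq by (simp add: A1_def)
    then show "A1 \<subset> A" using q by (auto simp: A1_def)
    have "h p = 0" by (simp add: h_def dist_d_def L2_set_def)
    then have "p \<in> A1" using p g by (simp add: A1_def)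
    then show "A1 \<noteq> {}" by blast
    fix j k assume j: "j \<in> A1" and k: "k \<in> A - A1"
    have "h j \<le> real i * g"
    proof (cases "j = p")
      case True
      then show ?thesis using g \<open>h p = 0\<close> by simp
    next
      case False
      have "h j / g < real i + 1" using j g by (simp add: A1_def field_simps)
      then have "\<phi> j \<le> i" unfolding \<phi>_def by linarith
      moreover have "\<phi> j \<noteq> i" using i(2) j False by (auto simp: A1_def)
      ultimately have "\<phi> j < i" by simp
      moreover have "0 \<le> h j / g" using h0 g by simp
      ultimately have "h j / g \<le> real i" unfolding \<phi>_def by linarith
      then show ?thesis using g by (simp add: field_simps)
    qed
    moreover have "(real i + 1) * g \<le> h k" using k by (auto simp: A1_def not_less)
    moreover have "h k \<le> dist_d d (y j) (y k) + h j"
      using dist_d_triangle[of d "y k" "y p" "y j"] unfolding h_def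
      by (simp add: dist_d_def L2_set_minus_commute[of "y k"])
    ultimately show "r / (real (card A) * sqrt (card A)) \<le> dist_d d (y j) (y k)"
      unfolding m_def[symmetric] g_def[symmetric] by (simp add: algebra_simps)
  qed
qed

lemma L2_set_block_le:
  assumes "finite A" "k \<in> A"
  shows "L2_set (\<lambda>i. Z (k, i)) {..<d} \<le> L2_set Z (A \<times> {..<d})"
proof -
  have "(\<Sum>i<d. (Z (k, i))\<^sup>2) \<le> (\<Sum>k\<in>A. \<Sum>i<d. (Z (k, i))\<^sup>2)"
    using assms by (intro member_le_sum) (auto intro: sum_nonneg)
  then show ?thesis unfolding L2_set_def by (simp add: sum.cartesian_product)
qed

text \<open>Each of the two points moves by at most the displacement of the whole configuration,
  hence the factor 2.\<close>

lemma block_dist_le: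
  fixes Z Z' :: "nat \<times> nat \<Rightarrow> real"
  assumes "finite A" "j \<in> A" "k \<in> A"
  shows "dist_d d (\<lambda>i. Z' (j, i)) (\<lambda>i. Z' (k, i))
    \<le> dist_d d (\<lambda>i. Z (j, i)) (\<lambda>i. Z (k, i)) + 2 * L2_set (\<lambda>p. Z' p - Z p) (A \<times> {..<d})"
proof -
  have "dist_d d (\<lambda>i. Z' (j, i)) (\<lambda>i. Z' (k, i)) \<le> dist_d d (\<lambda>i. Z' (j, i)) (\<lambda>i. Z (j, i))
      + (dist_d d (\<lambda>i. Z (j, i)) (\<lambda>i. Z (k, i)) + dist_d d (\<lambda>i. Z (k, i)) (\<lambda>i. Z' (k, i)))"
    using dist_d_triangle order_trans add_left_mono by meson
  moreover have "dist_d d (\<lambda>i. Z' (j, i)) (\<lambda>i. Z (j, i)) \<le> L2_set (\<lambda>p. Z' p - Z p) (A \<times> {..<d})"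
    unfolding dist_d_def using L2_set_block_le[OF assms(1,2), of "\<lambda>p. Z' p - Z p"] by simp
  moreover have "dist_d d (\<lambda>i. Z (k, i)) (\<lambda>i. Z' (k, i)) \<le> L2_set (\<lambda>p. Z' p - Z p) (A \<times> {..<d})"
    unfolding dist_d_def L2_set_minus_commute[of "\<lambda>i. Z (k, i)"]
    using L2_set_block_le[OF assms(1,3), of "\<lambda>p. Z' p - Z p"] by simp
  ultimately show ?thesis by linarith
qed

context evolution
begin

section \<open>The configuration in the frame of its centre of mass\<close>

definition rel_pos :: "nat set \<Rightarrow> real \<Rightarrow> nat \<times> nat \<Rightarrow> real" where
  "rel_pos A t = (\<lambda>(k, i). x k t i - (\<Sum>l\<in>A. x l t i) / card A)"

text \<open>Velocities after a possible collision are taken, so that the value at \<open>t\<close>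
  governs the flight starting at \<open>t\<close>, as \<open>expanding_path\<close>
  requires.\<close>

definition rel_vel :: "nat set \<Rightarrow> real \<Rightarrow> nat \<times> nat \<Rightarrow> real" where
  "rel_vel A t = (\<lambda>(k, i). vel_after x k t i - (\<Sum>l\<in>A. vel_after x l t i) / card A)"

definition collision_times :: "nat set \<Rightarrow> real \<Rightarrow> real \<Rightarrow> real set" where
  "collision_times A a b = {t \<in> {a..b}. \<exists>k\<in>A. \<exists>j. collide d n x j k t}"

lemma finite_collision_times: "finite (collision_times A a b)"
proof -
  have "collision_times A a b \<subseteq> (\<lambda>(j, k, t). t) ` {(j, k, t) \<in> collisions d n x. t \<in> {a..b}}"
  proof
    fix t assume "t \<in> collision_times A a b"
    then obtain j k where jk: "collide d n x j k t" "t \<in> {a..b}" by (auto simp: collision_times_def)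
    then have "j \<noteq> k" by (auto simp: collide_def touch_def)
    then have "(j, k, t) \<in> collisions d n x \<or> (k, j, t) \<in> collisions d n x"
      using jk collide_sym by (cases "j < k") (auto simp: collisions_def)
    then show "t \<in> (\<lambda>(j, k, t). t) ` {(j, k, t) \<in> collisions d n x. t \<in> {a..b}}"
      using jk(2) by force
  qed
  then show ?thesis using finite_collisions finite_surj by blast
qed

lemma expanding_path_rel_pos:
  assumes A: "A \<subseteq> {..<n}" "A \<noteq> {}" and iso: "\<And>t. a \<le> t \<Longrightarrow> t \<le> b \<Longrightarrow> isolated A t"
  shows "expanding_path (A \<times> {..<d}) (rel_pos A) (rel_vel A) a b (collision_times A a b)"
proof
  have fA: "finite A" using A finite_subset by blast
  show "finite (A \<times> {..<d})" using fA by simp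
  show "finite (collision_times A a b)" by (rule finite_collision_times)
  fix s u assume su: "a \<le> s" "s \<le> u" "u \<le> b" "collision_times A a b \<inter> {s<..<u} = {}"
  have k_lt: "k < n" if "k \<in> A" for k using that A by auto
  have free: "\<not> collide d n x j k t" if "k \<in> A" "s < t" "t < u" for j k t
  proof -
    have "t \<notin> collision_times A a b" using su(4) that by auto
    then show ?thesis using su that by (auto simp: collision_times_def)
  qed
  have flight: "x k u i = x k s i + (u - s) * vel_after x k s i" if "k \<in> A" for k i
    using no_collision_flight(1)[OF k_lt[OF that], of s u u i] free that su
    by (cases "s = u") auto
  show "rel_pos A u p = rel_pos A s p + (u - s) * rel_vel A s p" if "p \<in> A \<times> {..<d}" for p
  proof -
    obtain k i where p: "p = (k, i)" "k \<in> A" using \<open>p \<in> _\<close> by auto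
    have sums: "(\<Sum>l\<in>A. x l u i) = (\<Sum>l\<in>A. x l s i) + (u - s) * (\<Sum>l\<in>A. vel_after x l s i)"
      by (simp add: flight sum.distrib sum_distrib_left)
    show ?thesis
      unfolding p(1) rel_pos_def rel_vel_def prod.case sums flight[OF p(2)]
      by (simp add: algebra_simps add_divide_distrib diff_divide_distrib)
  qed
  \<comment> \<open>The correction term involves only sums over \<open>A\<close>. The velocity sums
    agree at \<open>s\<close> and \<open>u\<close> by conservation of momentum, so the energy law
    and the outward inequality carry over from the original frame.\<close>
  have split: "(\<Sum>p\<in>A \<times> {..<d}. (case p of (k, i) \<Rightarrow> f k i - sum (\<lambda>l. f l i) A / card A) *
        (case p of (k, i) \<Rightarrow> g k i - sum (\<lambda>l. g l i) A / card A))
     = (\<Sum>k\<in>A. \<Sum>i<d. f k i * g k i) - (\<Sum>i<d. sum (\<lambda>l. f l i) A * sum (\<lambda>l. g l i) A / card A)"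
    for f g :: "nat \<Rightarrow> nat \<Rightarrow> real"
  proof -
    have "(\<Sum>p\<in>A \<times> {..<d}. (case p of (k, i) \<Rightarrow> f k i - sum (\<lambda>l. f l i) A / card A) *
        (case p of (k, i) \<Rightarrow> g k i - sum (\<lambda>l. g l i) A / card A))
      = (\<Sum>k\<in>A. \<Sum>i<d. (f k i - sum (\<lambda>l. f l i) A / card A) * (g k i - sum (\<lambda>l. g l i) A / card A))"
      unfolding sum.cartesian_product by (rule sum.cong) auto
    also have "\<dots> = (\<Sum>i<d. \<Sum>k\<in>A. (f k i - sum (\<lambda>l. f l i) A / card A) * (g k i - sum (\<lambda>l. g l i) A / card A))"
      by (rule sum.swap)
    also have "\<dots> = (\<Sum>i<d. (\<Sum>k\<in>A. f k i * g k i) - sum (\<lambda>l. f l i) A * sum (\<lambda>l. g l i) A / card A)"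
      by (rule sum.cong[OF refl]) (rule sum_centered_mult[OF fA A(2)])
    also have "\<dots> = (\<Sum>k\<in>A. \<Sum>i<d. f k i * g k i) - (\<Sum>i<d. sum (\<lambda>l. f l i) A * sum (\<lambda>l. g l i) A / card A)"
      by (simp add: sum_subtractf sum.swap[of _ A])
    finally show ?thesis .
  qed
  have vb: "vel_before x k u = vel_after x k s" if "k \<in> A" "s < u" for k
    using no_collision_flight(2)[OF k_lt[OF that(1)] that(2)] free that by blast
  have iso_u: "isolated A u" using iso su by auto
  have mom: "(\<Sum>l\<in>A. vel_after x l u i) = (\<Sum>l\<in>A. vel_after x l s i)" if "s < u" for i
    using momentum_conserved[OF A(1) iso_u] vb[OF _ that] by simp
  show "(\<Sum>p\<in>A \<times> {..<d}. (rel_vel A u p)\<^sup>2) = (\<Sum>p\<in>A \<times> {..<d}. (rel_vel A s p)\<^sup>2)"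
  proof (cases "s < u")
    case True
    then show ?thesis
      using energy_conserved[OF A(1) iso_u] vb[OF _ True] mom[OF True]
      unfolding power2_eq_square rel_vel_def split by simp
  qed (use su in simp)
  show "(\<Sum>p\<in>A \<times> {..<d}. rel_pos A u p * rel_vel A s p) \<le> (\<Sum>p\<in>A \<times> {..<d}. rel_pos A u p * rel_vel A u p)"
  proof (cases "s < u")
    case True
    then show ?thesis
      using outward_increases[OF A(1) iso_u] vb[OF _ True] mom[OF True]
      unfolding rel_vel_def rel_pos_def split by simp
  qed (use su in simp)
qed

lemma rel_pos_dist: "dist_d d (\<lambda>i. rel_pos A t (j, i)) (\<lambda>i. rel_pos A t (k, i)) = dist_d d (x j t) (x k t)"
  by (simp add: dist_d_def rel_pos_def)

lemma finite_collisions_among: "finite (collisions_among d n x A {a..b})"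
  by (rule finite_subset[OF _ finite_collisions[of a b]]) (auto simp: collisions_among_def)

end

section \<open>Counting collisions\<close>

context evolution
begin

text \<open>Every ball has at most one partner, so its first ball determines a collision. This
  serves intervals of length zero, which the sparseness hypothesis does not cover.\<close>

lemma card_collisions_at_instant: "card (collisions_among d n x A {t..t}) \<le> n"
proof -
  have "card (collisions_among d n x A {t..t}) \<le> card {..<n}"
  proof (rule card_inj_on_le[where f = fst])
    show "inj_on fst (collisions_among d n x A {t..t})"
    proof (rule inj_onI)
      fix c c' assume "c \<in> collisions_among d n x A {t..t}" "c' \<in> collisions_among d n x A {t..t}"
        and "fst c = fst c'"
      then obtain j k l where c: "c = (j, k, t)" "c' = (j, l, t)"
          and jk: "collide d n x j k t" and jl: "collide d n x j l t"
        by (auto simp: collisions_among_def collisions_def)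
      have "k = l"
        by (rule touch_unique[OF touch_sym[OF collide_touch[OF jk]] touch_sym[OF collide_touch[OF jl]]])
      then show "c = c'" using c by simp
    qed
    show "fst ` collisions_among d n x A {t..t} \<subseteq> {..<n}"
      by (auto simp: collisions_among_def collisions_def collide_def touch_def)
  qed simp
  then show ?thesis by simp
qed

section \<open>Families at large radius split into smaller ones\<close>

lemma no_touch_isolated:
  assumes "isolated A t" "B \<subseteq> A" "\<And>j k. j \<in> B \<Longrightarrow> k \<in> A - B \<Longrightarrow> dist_d d (x j t) (x k t) \<noteq> 2"
  shows "isolated B t"
  using assms unfolding isolated_def collide_def touch_def by blast

text \<open>Zero speed in the frame of the centre of mass means equal velocities after
  \<open>t\<close>, but a collision leaves a positive speed of separation.\<close>

lemma zero_speed_no_collisions: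
  assumes A: "A \<subseteq> {..<n}" and V: "L2_set (rel_vel A t) (A \<times> {..<d}) = 0" and jk: "j \<in> A" "k \<in> A"
  shows "\<not> collide d n x j k t"
proof
  assume coll: "collide d n x j k t"
  have "finite (A \<times> {..<d})" using A finite_subset by blast
  then have zero: "rel_vel A t p = 0" if "p \<in> A \<times> {..<d}" for p
    using V that L2_set_eq_0_iff by blast
  have "vel_after x j t i = vel_after x k t i" if "i < d" for i
    using zero[of "(j, i)"] zero[of "(k, i)"] that jk by (simp add: rel_vel_def)
  then show False using separating_after_collision[OF coll] by simp
qed

text \<open>Scaled to radius 1, the configuration at time \<open>s\<close> has a gap of at least
  \<open>1 / c\<close>. The turn moves every scaled point by at most \<open>1 / (4 * c)\<close>,
  which leaves \<open>1 / (2 * c)\<close> across the gap; at radius at least \<open>8 * c\<close>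
  this is a true distance of at least 4, more than the contact distance 2.\<close>

lemma split_on_small_turn:
  assumes A: "A \<subseteq> {..<n}" and iso: "\<And>t. s \<le> t \<Longrightarrow> t \<le> u \<Longrightarrow> isolated A t" and su: "s \<le> u"
    and c: "c > 0" "real (card A) * sqrt (card A) \<le> c"
    and R: "\<And>t. s \<le> t \<Longrightarrow> t \<le> u \<Longrightarrow> 8 * c \<le> L2_set (rel_pos A t) (A \<times> {..<d})"
    and turn: "\<And>t. s \<le> t \<Longrightarrow> t \<le> u \<Longrightarrow>
      L2_set (\<lambda>p. rel_pos A t p / L2_set (rel_pos A t) (A \<times> {..<d})
                - rel_pos A s p / L2_set (rel_pos A s) (A \<times> {..<d})) (A \<times> {..<d}) \<le> 1 / (4 * c)"
  obtains A1 where "A1 \<subset> A" "A1 \<noteq> {}"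
    "\<And>t. s \<le> t \<Longrightarrow> t \<le> u \<Longrightarrow> isolated A1 t" "\<And>t. s \<le> t \<Longrightarrow> t \<le> u \<Longrightarrow> isolated (A - A1) t"
    "collisions_among d n x A {s..u} \<subseteq>
       collisions_among d n x A1 {s..u} \<union> collisions_among d n x (A - A1) {s..u}"
proof -
  have fA: "finite A" using A finite_subset by blast
  define r where "r t = L2_set (rel_pos A t) (A \<times> {..<d})" for t
  define U where "U t p = rel_pos A t p / r t" for t p
  have rpos: "r t > 0" if "s \<le> t" "t \<le> u" for t using R[OF that] c by (simp add: r_def)
  have "A \<noteq> {}" using R[OF order_refl su] c by auto
  then have m: "real (card A) > 0" using fA by (simp add: card_gt_0_iff)
  have center: "(\<Sum>k\<in>A. U s (k, i)) = 0" for i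
    using m by (simp add: U_def rel_pos_def sum_subtractf flip: sum_divide_distrib)
  have unit: "(\<Sum>k\<in>A. \<Sum>i<d. (U s (k, i))\<^sup>2) = 1\<^sup>2"
  proof -
    have "(\<Sum>k\<in>A. \<Sum>i<d. (U s (k, i))\<^sup>2) = (\<Sum>p\<in>A \<times> {..<d}. (rel_pos A s p)\<^sup>2) / (r s)\<^sup>2"
      by (simp add: U_def power_divide sum.cartesian_product sum_divide_distrib)
    also have "\<dots> = 1" using rpos[OF order_refl su] by (simp add: r_def flip: L2_set_sq)
    finally show ?thesis by simp
  qed
  obtain A1 where A1: "A1 \<subset> A" "A1 \<noteq> {}"
    and gap: "\<And>j k. j \<in> A1 \<Longrightarrow> k \<in> A - A1 \<Longrightarrow>
        1 / (real (card A) * sqrt (card A)) \<le> dist_d d (\<lambda>i. U s (j, i)) (\<lambda>i. U s (k, i))"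
    using split_by_gap[OF fA, of d "\<lambda>k i. U s (k, i)" 1] center unit by auto
  have apart: "dist_d d (x j t) (x k t) \<noteq> 2" if jk: "j \<in> A1" "k \<in> A - A1" and t: "s \<le> t" "t \<le> u" for j k t
  proof -
    have "1 / c \<le> 1 / (real (card A) * sqrt (card A))"
      using c m by (intro divide_left_mono) auto
    also have "\<dots> \<le> dist_d d (\<lambda>i. U s (j, i)) (\<lambda>i. U s (k, i))" by (rule gap[OF jk])
    also have "\<dots> \<le> dist_d d (\<lambda>i. U t (j, i)) (\<lambda>i. U t (k, i)) + 2 * L2_set (\<lambda>p. U s p - U t p) (A \<times> {..<d})"
      using jk A1(1) by (intro block_dist_le[OF fA]) auto
    also have "L2_set (\<lambda>p. U s p - U t p) (A \<times> {..<d}) \<le> 1 / (4 * c)"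
      using turn[OF t] unfolding L2_set_minus_commute[of "U s"] by (simp add: U_def r_def)
    finally have "1 / (2 * c) \<le> dist_d d (\<lambda>i. U t (j, i)) (\<lambda>i. U t (k, i))"
      using c by (simp add: field_simps)
    also have "\<dots> = dist_d d (x j t) (x k t) / r t"
    proof -
      have "dist_d d (\<lambda>i. U t (j, i)) (\<lambda>i. U t (k, i))
          = L2_set (\<lambda>i. (x j t i - x k t i) * (1 / r t)) {..<d}"
        by (simp add: dist_d_def U_def rel_pos_def diff_divide_distrib)
      also have "\<dots> = dist_d d (x j t) (x k t) * (1 / r t)"
        unfolding dist_d_def using rpos[OF t] by (subst L2_set_left_distrib) auto
      finally show ?thesis by simp
    qed
    finally have "r t / (2 * c) \<le> dist_d d (x j t) (x k t)"
      using rpos[OF t] by (simp add: field_simps)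
    moreover have "4 \<le> r t / (2 * c)" using R[OF t] c by (simp add: r_def field_simps)
    ultimately show ?thesis by linarith
  qed
  show thesis
  proof (rule that[OF A1])
    show "isolated A1 t" if "s \<le> t" "t \<le> u" for t
      by (rule no_touch_isolated[OF iso[OF that]]) (use A1 apart that in auto)
    show "isolated (A - A1) t" if t: "s \<le> t" "t \<le> u" for t
    proof (rule no_touch_isolated[OF iso[OF t]])
      fix j k assume "j \<in> A - A1" "k \<in> A - (A - A1)"
      then show "dist_d d (x j t) (x k t) \<noteq> 2"
        using apart[of k j t] t dist_d_commute by auto
    qed auto
    show "collisions_among d n x A {s..u} \<subseteq>
       collisions_among d n x A1 {s..u} \<union> collisions_among d n x (A - A1) {s..u}"
    proof
      fix c assume "c \<in> collisions_among d n x A {s..u}"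
      then obtain j k t where c: "c = (j, k, t)" "(j, k, t) \<in> collisions d n x" "j \<in> A" "k \<in> A"
          "s \<le> t" "t \<le> u"
        by (auto simp: collisions_among_def)
      then have D: "dist_d d (x j t) (x k t) = 2" by (auto simp: collisions_def collide_def touch_def)
      then have "dist_d d (x k t) (x j t) = 2" by (simp add: dist_d_commute)
      then have "j \<in> A1 \<longleftrightarrow> k \<in> A1" using D apart[of j k t] apart[of k j t] c by auto
      then show "c \<in> collisions_among d n x A1 {s..u} \<union> collisions_among d n x (A - A1) {s..u}"
        using c by (auto simp: collisions_among_def)
    qed
  qed
qed

text \<open>There are at most \<open>4 pi c + 1\<close>, hence at most \<open>14 * c\<close>, angle
  levels of width \<open>1 / (4 * c)\<close>, and on each of them the family splits into two smaller
  isolated ones with at most \<open>M\<close> collisions each. \<open>T\<close> is only required to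
  be convex, since the stages before and after the close one are half-open intervals.\<close>

lemma large_radius_bound:
  assumes A: "A \<subseteq> {..<n}" and iso: "\<And>t. a \<le> t \<Longrightarrow> t \<le> b \<Longrightarrow> isolated A t"
    and T: "T \<subseteq> {a..b}" "\<And>s u t. s \<in> T \<Longrightarrow> u \<in> T \<Longrightarrow> s \<le> t \<Longrightarrow> t \<le> u \<Longrightarrow> t \<in> T"
    and c: "c \<ge> 1" "real (card A) * sqrt (card A) \<le> c"
    and R: "\<And>t. t \<in> T \<Longrightarrow> 8 * c \<le> L2_set (rel_pos A t) (A \<times> {..<d})"
    and M0: "0 \<le> M" and M: "\<And>B s u. B \<subset> A \<Longrightarrow> B \<noteq> {} \<Longrightarrow> s \<le> u \<Longrightarrow> (\<And>t. s \<le> t \<Longrightarrow> t \<le> u \<Longrightarrow> isolated B t)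
        \<Longrightarrow> real (card (collisions_among d n x B {s..u})) \<le> M"
  shows "real (card (collisions_among d n x A T)) \<le> 28 * c * M"
proof (cases "collisions_among d n x A T = {}")
  case True
  then show ?thesis using c M0 by simp
next
  case False
  then obtain j0 k0 t0 where "(j0, k0, t0) \<in> collisions d n x" "j0 \<in> A" "k0 \<in> A" "t0 \<in> T"
    by (auto simp: collisions_among_def)
  then have t0: "t0 \<in> T" "collide d n x j0 k0 t0" "A \<noteq> {}" "j0 \<in> A" "k0 \<in> A" by (auto simp: collisions_def)
  let ?J = "A \<times> {..<d}"
  interpret E: expanding_path ?J "rel_pos A" "rel_vel A" a b "collision_times A a b"
    by (rule expanding_path_rel_pos[OF A t0(3) iso])
  have rpos: "E.rad t > 0" if "t \<in> T" for t using R[OF that] c by (simp add: E.rad_def)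
  have V: "E.speed > 0"
    using zero_speed_no_collisions[OF A, of t0 j0 k0] t0 E.speed_eq[of t0] T(1)
    by (auto simp: E.speed_def less_le)
  define \<delta> where "\<delta> = 1 / (4 * c)"
  have \<delta>: "\<delta> > 0" using c by (simp add: \<delta>_def)
  let ?S = "collisions_among d n x A T"
  define \<phi> where "\<phi> = (\<lambda>(j::nat, k::nat, t). nat \<lfloor>E.angle t / \<delta>\<rfloor>)"
  have fS: "finite ?S"
    by (rule finite_subset[OF _ finite_collisions_among[of A a b]]) (use T in \<open>auto simp: collisions_among_def\<close>)
  have "real (card ?S) \<le> real (card {..nat \<lfloor>pi / \<delta>\<rfloor>}) * (2 * M)"
  proof (rule card_le_fibres[OF fS])
    show "finite {..nat \<lfloor>pi / \<delta>\<rfloor>}" by simp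
    fix q assume "q \<in> ?S"
    then obtain j k t where q: "q = (j, k, t)" "t \<in> T" by (auto simp: collisions_among_def)
    have "E.angle t \<le> pi" using E.angle_bounds(2)[OF _ _ V rpos[OF q(2)]] q T by auto
    then have "E.angle t / \<delta> \<le> pi / \<delta>" using \<delta> by (simp add: divide_right_mono)
    then show "\<phi> q \<in> {..nat \<lfloor>pi / \<delta>\<rfloor>}"
      by (simp add: q \<phi>_def nat_mono floor_mono)
  next
    fix i
    let ?F = "{q \<in> ?S. \<phi> q = i}"
    show "real (card ?F) \<le> 2 * M"
    proof (cases "?F = {}")
      case True
      show ?thesis unfolding True using M0 by simp
    next
      case False
      define times where "times = (\<lambda>(j, k, t). t) ` ?F"
      have ft: "finite times" "times \<noteq> {}" using fS False by (auto simp: times_def)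
      \<comment> \<open>The first and last collision times on this level. Both angles lie in the
        same slot, and by monotonicity so do all angles in between.\<close>
      define s where "s = Min times"
      define u where "u = Max times"
      have su: "s \<in> times" "u \<in> times" "s \<le> u" "\<And>t. t \<in> times \<Longrightarrow> s \<le> t \<and> t \<le> u"
        using ft by (auto simp: s_def u_def)
      have times: "t \<in> T" "nat \<lfloor>E.angle t / \<delta>\<rfloor> = i" if "t \<in> times" for t
        using that by (auto simp: times_def \<phi>_def collisions_among_def)
      have sub: "t \<in> T" if "s \<le> t" "t \<le> u" for t
        using T(2) times(1) su that by blast
      have ab: "a \<le> s" "u \<le> b" using times(1)[OF su(1)] times(1)[OF su(2)] T(1) by auto
      have isoA: "isolated A t" if "s \<le> t" "t \<le> u" for t using iso that ab by simp
      have narrow: "E.angle s - E.angle u \<le> \<delta>"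
      proof -
        have "0 \<le> E.angle u" "0 \<le> E.angle s"
          using ab su(3) V rpos times(1) su(1,2) by (auto intro!: E.angle_bounds(1))
        then have "0 \<le> E.angle u / \<delta>" "0 \<le> E.angle s / \<delta>" using \<delta> by simp_all
        then have "E.angle s / \<delta> - E.angle u / \<delta> \<le> 1"
          using times(2)[OF su(1)] times(2)[OF su(2)] by linarith
        then show ?thesis using \<delta> by (simp add: field_simps)
      qed
      have turn: "L2_set (\<lambda>p. rel_pos A t p / L2_set (rel_pos A t) ?J - rel_pos A s p / L2_set (rel_pos A s) ?J) ?J
            \<le> 1 / (4 * c)" if t: "s \<le> t" "t \<le> u" for t
      proof -
        have "L2_set (\<lambda>p. rel_pos A t p / E.rad t - rel_pos A s p / E.rad s) ?J \<le> E.angle s - E.angle t"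
          by (rule E.chord_le_angle_decrease) (use t ab V rpos sub in auto)
        moreover have "E.angle u \<le> E.angle t"
          by (rule E.angle_antimono) (use t ab V rpos sub in auto)
        ultimately show ?thesis using narrow by (simp add: \<delta>_def E.rad_def)
      qed
      obtain A1 where A1: "A1 \<subset> A" "A1 \<noteq> {}"
        "\<And>t. s \<le> t \<Longrightarrow> t \<le> u \<Longrightarrow> isolated A1 t" "\<And>t. s \<le> t \<Longrightarrow> t \<le> u \<Longrightarrow> isolated (A - A1) t"
        "collisions_among d n x A {s..u} \<subseteq>
          collisions_among d n x A1 {s..u} \<union> collisions_among d n x (A - A1) {s..u}"
        by (rule split_on_small_turn[OF A isoA su(3) _ c(2) R[OF sub] turn]) (use c(1) in auto)
      have "?F \<subseteq> collisions_among d n x A {s..u}"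
      proof
        fix q assume q: "q \<in> ?F"
        then obtain j k t where "q = (j, k, t)" by (cases q) auto
        moreover have "t \<in> times" using q \<open>q = _\<close> by (force simp: times_def)
        ultimately show "q \<in> collisions_among d n x A {s..u}"
          using q su(4)[of t] by (auto simp: collisions_among_def)
      qed
      then have "card ?F \<le> card (collisions_among d n x A1 {s..u} \<union> collisions_among d n x (A - A1) {s..u})"
        using A1(5) by (intro card_mono) (auto intro: finite_collisions_among)
      also have "\<dots> \<le> card (collisions_among d n x A1 {s..u}) + card (collisions_among d n x (A - A1) {s..u})"
        by (rule card_Un_le)
      finally have "real (card ?F) \<le> real (card (collisions_among d n x A1 {s..u}))
          + real (card (collisions_among d n x (A - A1) {s..u}))" by simp
      also have "\<dots> \<le> M + M"
        using A1 su(3) by (intro add_mono M) auto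
      finally show ?thesis by simp
    qed
  qed
  also have "\<dots> \<le> (14 * c) * (2 * M)"
  proof (rule mult_right_mono)
    have "real (card {..nat \<lfloor>pi / \<delta>\<rfloor>}) = of_int \<lfloor>pi / \<delta>\<rfloor> + 1" using \<delta> by simp
    also have "\<dots> \<le> pi / \<delta> + 1" by simp
    also have "\<dots> = 4 * pi * c + 1" by (simp add: \<delta>_def)
    also have "\<dots> \<le> 4 * 3.2 * c + 1" using pi_approx c(1) by (intro add_mono mult_right_mono mult_left_mono) auto
    also have "\<dots> \<le> 14 * c" using c(1) by simp
    finally show "real (card {..nat \<lfloor>pi / \<delta>\<rfloor>}) \<le> 14 * c" .
    show "0 \<le> 2 * M" using M0 by simp
  qed
  finally show ?thesis by simp
qed

end

text \<open>The negation of the desired conclusion, for general \<open>\<rho>\<close> and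
  \<open>K\<close>. The bound \<open>K \<ge> 1\<close> lets the at most \<open>n\<close> collisions
  of a single instant count as \<open>n * K\<close>.\<close>

locale sparse_clusters = evolution +
  fixes \<rho> K :: real
  assumes \<rho>: "\<rho> > 0" and K: "K \<ge> 1"
    and sparse: "\<And>B s u. B \<subseteq> {..<n} \<Longrightarrow> s < u \<Longrightarrow> rho_connected d n x \<rho> B {s..u} \<Longrightarrow>
      real (card (collisions_among d n x B {s..u})) \<le> K"
begin

text \<open>If no distance within a family varies by more than \<open>\<rho>\<close>, then balls that collide at some time
  are joined in the graph at all times.\<close>

lemma slow_variation_bound:
  assumes A: "A \<subseteq> {..<n}" and su: "s \<le> u"
    and slow: "\<And>j k t t'. j \<in> A \<Longrightarrow> k \<in> A \<Longrightarrow> t \<in> {s..u} \<Longrightarrow> t' \<in> {s..u} \<Longrightarrow>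
      dist_d d (x j t') (x k t') \<le> dist_d d (x j t) (x k t) + \<rho>"
  shows "real (card (collisions_among d n x A {s..u})) \<le> real n * K"
proof (cases "s = u")
  case True
  have "real (card (collisions_among d n x A {s..u})) \<le> real n"
    using card_collisions_at_instant True by simp
  also have "\<dots> \<le> real n * K" using K by (simp add: mult_le_cancel_left1)
  finally show ?thesis .
next
  case False
  \<comment> \<open>Collisions of the whole window are collected into one graph that does not depend
    on time. Its components \<open>B k\<close> are the families to which sparseness applies.\<close>
  define G where "G = {(j, k). j \<in> A \<and> k \<in> A \<and> (\<exists>t\<in>{s..u}. collide d n x j k t)}"
  define B where "B k = G\<^sup>* `` {k}" for k
  have BA: "B k \<subseteq> A" if "k \<in> A" for k
  proof
    fix l assume "l \<in> B k"
    then have "(k, l) \<in> G\<^sup>*" by (simp add: B_def)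
    then show "l \<in> A" using that by (induction rule: rtrancl_induct) (auto simp: G_def)
  qed
  have conn: "rho_connected d n x \<rho> (B k) {s..u}" if "k \<in> A" for k
    unfolding rho_connected_def
  proof
    fix t assume t: "t \<in> {s..u}"
    have "G \<subseteq> Gamma_edges d n x \<rho> t"
    proof
      fix e assume "e \<in> G"
      then obtain j k t' where e: "e = (j, k)" "j \<in> A" "k \<in> A" "t' \<in> {s..u}" "collide d n x j k t'"
        by (auto simp: G_def)
      then have "dist_d d (x j t) (x k t) \<le> 2 + \<rho>"
        using slow[of j k t' t] t by (auto simp: collide_def touch_def)
      then show "e \<in> Gamma_edges d n x \<rho> t"
        using e by (auto simp: Gamma_edges_def collide_def touch_def)
    qed
    then have "B k \<subseteq> (Gamma_edges d n x \<rho> t)\<^sup>* `` {k}"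
      unfolding B_def using rtrancl_mono by blast
    moreover have "(Gamma_edges d n x \<rho> t)\<^sup>* `` {k} \<in> Gamma_components d n x \<rho> t"
      unfolding Gamma_components_def using that A by (intro quotientI) auto
    ultimately show "\<exists>C\<in>Gamma_components d n x \<rho> t. B k \<subseteq> C" by blast
  qed
  have fA: "finite A" using A finite_subset by blast
  have "collisions_among d n x A {s..u} \<subseteq> (\<Union>k\<in>A. collisions_among d n x (B k) {s..u})"
  proof
    fix c assume "c \<in> collisions_among d n x A {s..u}"
    then obtain j k t where c: "c = (j, k, t)" "(j, k, t) \<in> collisions d n x" "j \<in> A" "k \<in> A" "t \<in> {s..u}"
      by (auto simp: collisions_among_def)
    then have "(j, k) \<in> G" by (auto simp: G_def collisions_def)
    then have "j \<in> B j" "k \<in> B j" by (auto simp: B_def)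
    then show "c \<in> (\<Union>k\<in>A. collisions_among d n x (B k) {s..u})"
      using c by (auto simp: collisions_among_def)
  qed
  then have "card (collisions_among d n x A {s..u}) \<le> card (\<Union>k\<in>A. collisions_among d n x (B k) {s..u})"
    using fA by (intro card_mono) (auto intro: finite_collisions_among)
  also have "\<dots> \<le> (\<Sum>k\<in>A. card (collisions_among d n x (B k) {s..u}))" by (rule card_UN_le[OF fA])
  finally have "real (card (collisions_among d n x A {s..u}))
      \<le> (\<Sum>k\<in>A. real (card (collisions_among d n x (B k) {s..u})))" by (simp flip: of_nat_sum)
  \<comment> \<open>Components are indexed by their balls, with repetition, which costs the factor
    \<open>n\<close>.\<close>
  also have "\<dots> \<le> real (card A) * K"
    using BA A conn False su by (intro sum_bounded_above sparse) fastforce+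
  also have "\<dots> \<le> real n * K"
    using card_mono[OF _ A] K by (intro mult_right_mono) auto
  finally show ?thesis .
qed

lemma small_radius_bound:
  assumes A: "A \<subseteq> {..<n}" "A \<noteq> {}" and iso: "\<And>t. a \<le> t \<Longrightarrow> t \<le> b \<Longrightarrow> isolated A t"
    and pq: "a \<le> p" "p \<le> q" "q \<le> b" and V: "L2_set (rel_vel A a) (A \<times> {..<d}) > 0"
    and R: "L2_set (rel_pos A p) (A \<times> {..<d}) \<le> R" "L2_set (rel_pos A q) (A \<times> {..<d}) \<le> R"
  shows "real (card (collisions_among d n x A {p..q})) \<le> (4 * R / \<rho> + 1) * (real n * K)"
proof -
  let ?J = "A \<times> {..<d}"
  interpret E: expanding_path ?J "rel_pos A" "rel_vel A" a b "collision_times A a b"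
    by (rule expanding_path_rel_pos[OF A iso])
  have V: "E.speed > 0" using V by (simp add: E.speed_def)
  have fA: "finite A" using A finite_subset by blast
  \<comment> \<open>During \<open>\<tau>\<close> the configuration moves by at most
    \<open>\<rho> / 2\<close>, so a distance between two balls changes by at most
    \<open>\<rho>\<close>. The speed cancels in the number of windows, at most
    \<open>2 R / speed / \<tau> + 1\<close>.\<close>
  define \<tau> where "\<tau> = \<rho> / (2 * E.speed)"
  have \<tau>: "\<tau> > 0" using \<rho> V by (simp add: \<tau>_def)
  define N where "N = nat \<lfloor>(q - p) / \<tau>\<rfloor>"
  let ?S = "collisions_among d n x A {p..q}"
  define \<phi> where "\<phi> = (\<lambda>(j::nat, k::nat, t). nat \<lfloor>(t - p) / \<tau>\<rfloor>)"
  have lip: "dist_d d (x j t') (x k t') \<le> dist_d d (x j t) (x k t) + \<rho>"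
    if jk: "j \<in> A" "k \<in> A" and t: "a \<le> t" "t \<le> b" "a \<le> t'" "t' \<le> b" "\<bar>t' - t\<bar> \<le> \<tau>" for j k t t'
  proof -
    have "L2_set (\<lambda>p. rel_pos A t' p - rel_pos A t p) ?J \<le> E.speed * \<bar>t' - t\<bar>"
      using E.lipschitz[of t t'] E.lipschitz[of t' t] t
        L2_set_minus_commute[of "rel_pos A t'" "rel_pos A t" ?J] by (cases "t \<le> t'") auto
    also have "\<dots> \<le> E.speed * \<tau>" using V t by (intro mult_left_mono) auto
    also have "\<dots> = \<rho> / 2" using V by (simp add: \<tau>_def)
    finally show ?thesis
      using block_dist_le[OF fA jk, of d "rel_pos A t'" "rel_pos A t"] by (simp add: rel_pos_dist)
  qed
  have "real (card ?S) \<le> real (card {..N}) * (real n * K)"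
  proof (rule card_le_fibres[OF finite_collisions_among])
    show "finite {..N}" by simp
    fix c assume "c \<in> ?S"
    then obtain j k t where "c = (j, k, t)" "t \<le> q" by (auto simp: collisions_among_def)
    then show "\<phi> c \<in> {..N}"
      using \<tau> by (auto simp: \<phi>_def N_def intro!: nat_mono floor_mono divide_right_mono)
  next
    fix i
    define s where "s = p + real i * \<tau>"
    \<comment> \<open>The last window is truncated at \<open>q\<close>, so that it stays where the
      family is isolated; a window starting after \<open>q\<close> contains no collision.\<close>
    define u where "u = min q (s + \<tau>)"
    have sub: "{c \<in> ?S. \<phi> c = i} \<subseteq> collisions_among d n x A {s..u}"
    proof
      fix c assume c: "c \<in> {c \<in> ?S. \<phi> c = i}"
      then obtain j k t where jkt: "c = (j, k, t)" "p \<le> t" "t \<le> q" by (auto simp: collisions_among_def)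
      then have i: "nat \<lfloor>(t - p) / \<tau>\<rfloor> = i" using c by (simp add: \<phi>_def)
      have "0 \<le> (t - p) / \<tau>" using jkt \<tau> by simp
      then have "real i \<le> (t - p) / \<tau>" "(t - p) / \<tau> \<le> real i + 1" using i by linarith+
      then have "real i * \<tau> \<le> t - p" "t - p \<le> (real i + 1) * \<tau>" using \<tau> by (simp_all add: field_simps)
      then have "s \<le> t" "t \<le> u" using jkt by (simp_all add: s_def u_def algebra_simps)
      then show "c \<in> collisions_among d n x A {s..u}" using c jkt by (auto simp: collisions_among_def)
    qed
    show "real (card {c \<in> ?S. \<phi> c = i}) \<le> real n * K"
    proof (cases "s \<le> u")
      case True
      have "real (card {c \<in> ?S. \<phi> c = i}) \<le> real (card (collisions_among d n x A {s..u}))"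
        using card_mono[OF finite_collisions_among sub] by simp
      also have "\<dots> \<le> real n * K"
      proof (rule slow_variation_bound[OF A(1) True])
        fix j k t t' assume "j \<in> A" "k \<in> A" "t \<in> {s..u}" "t' \<in> {s..u}"
        moreover have "0 \<le> real i * \<tau>" using \<tau> by simp
        then have "a \<le> s" "u \<le> b" "u \<le> s + \<tau>" using pq by (auto simp: s_def u_def)
        ultimately show "dist_d d (x j t') (x k t') \<le> dist_d d (x j t) (x k t) + \<rho>"
          by (intro lip) auto
      qed
      finally show ?thesis .
    next
      case False
      then have empty: "{c \<in> ?S. \<phi> c = i} = {}" using sub by (auto simp: collisions_among_def)
      show ?thesis unfolding empty using K by simp
    qed
  qed
  also have "\<dots> \<le> (4 * R / \<rho> + 1) * (real n * K)"
  proof (rule mult_right_mono)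
    have "q - p \<le> 2 * R / E.speed"
      by (rule E.small_radius_time) (use pq R V in \<open>auto simp: E.rad_def\<close>)
    then have "(q - p) / \<tau> \<le> 2 * R / E.speed / \<tau>" using \<tau> by (intro divide_right_mono) auto
    also have "\<dots> = 4 * R / \<rho>" using V by (simp add: \<tau>_def)
    finally have "(q - p) / \<tau> \<le> 4 * R / \<rho>" .
    moreover have "real N \<le> (q - p) / \<tau>" using pq \<tau> by (simp add: N_def)
    ultimately show "real (card {..N}) \<le> 4 * R / \<rho> + 1" by simp
    show "0 \<le> real n * K" using K by simp
  qed
  finally show ?thesis .
qed

end

section \<open>The bound for sparse clusters\<close>

context sparse_clusters
begin

text \<open>If smaller families have at most \<open>M\<close> collisions, the two far stages give
  \<open>2 * 28 * c * M\<close> and the close stage gives \<open>P\<close>, itself at most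
  \<open>56 * c * M\<close>; hence the factor \<open>112 * c\<close> per ball. The value of
  \<open>c\<close> comes from \<open>n\<close> rather than \<open>card A\<close> so that it stays
  fixed during the induction.\<close>

lemma family_bound:
  defines "c \<equiv> real n * sqrt n"
  defines "P \<equiv> (32 * c / \<rho> + 1) * (real n * K)"
  assumes "A \<subseteq> {..<n}" "A \<noteq> {}" "a \<le> b" "\<And>t. a \<le> t \<Longrightarrow> t \<le> b \<Longrightarrow> isolated A t"
  shows "real (card (collisions_among d n x A {a..b})) \<le> (112 * c) ^ (card A - 1) * P"
  using assms(3-)
proof (induction "card A" arbitrary: A a b rule: less_induct)
  case less
  note A = less.prems(1,2) and ab = less.prems(3) and iso = less.prems(4)
  have fA: "finite A" using A finite_subset by blast
  have "n > 0" using A by auto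
  have c: "c \<ge> 1"
  proof -
    have "1 * 1 \<le> real n * sqrt n" using \<open>n > 0\<close> by (intro mult_mono) auto
    then show ?thesis by (simp add: c_def)
  qed
  have "card A \<le> n" using card_mono[OF _ A(1)] by simp
  then have cA: "real (card A) * sqrt (card A) \<le> c"
    unfolding c_def by (intro mult_mono) auto
  have P: "0 \<le> P" using c \<rho> K unfolding P_def by (intro mult_nonneg_nonneg add_nonneg_nonneg) auto
  let ?C = "collisions_among d n x A"
  let ?V = "L2_set (rel_vel A a) (A \<times> {..<d})"
  let ?r = "\<lambda>t. L2_set (rel_pos A t) (A \<times> {..<d})"
  interpret E: expanding_path "A \<times> {..<d}" "rel_pos A" "rel_vel A" a b "collision_times A a b"
    by (rule expanding_path_rel_pos[OF A iso])
  show ?case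
  \<comment> \<open>Zero speed is treated apart because the lengths of the close stage and of its
    windows are multiples of \<open>1 / speed\<close>.\<close>
  proof (cases "card A \<le> 1 \<or> ?V = 0")
    case True
    have "?C {a..b} = {}"
    proof (rule ccontr)
      assume "?C {a..b} \<noteq> {}"
      then obtain j k t where jkt: "j \<in> A" "k \<in> A" "j < k" "collide d n x j k t" "a \<le> t" "t \<le> b"
        by (auto simp: collisions_among_def collisions_def)
      have "card {j, k} \<le> card A" using jkt fA by (intro card_mono) auto
      then have "card A > 1" using \<open>j < k\<close> by simp
      then have "L2_set (rel_vel A t) (A \<times> {..<d}) = 0"
        using True E.speed_eq[of t] jkt by (simp add: E.speed_def)
      then show False using zero_speed_no_collisions[OF A(1)] jkt by blast
    qed
    then show ?thesis using P c by simp
  next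
    case False
    then have m: "card A \<ge> 2" and V: "?V > 0" by (auto simp: less_le)
    define M where "M = (112 * c) ^ (card A - 2) * P"
    have M0: "0 \<le> M" using P c by (simp add: M_def)
    have IH: "real (card (collisions_among d n x B {s..u})) \<le> M"
      if B: "B \<subset> A" "B \<noteq> {}" and su: "s \<le> u" "\<And>t. s \<le> t \<Longrightarrow> t \<le> u \<Longrightarrow> isolated B t" for B s u
    proof -
      have lt: "card B < card A" using B fA by (intro psubset_card_mono)
      have "real (card (collisions_among d n x B {s..u})) \<le> (112 * c) ^ (card B - 1) * P"
        using less.hyps[OF lt _ B(2) su] B(1) A(1) by blast
      also have "\<dots> \<le> M" unfolding M_def
        using lt c P by (intro mult_right_mono power_increasing) auto
      finally show ?thesis .
    qed
    have large: "real (card (?C T)) \<le> 28 * c * M"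
      if "T \<subseteq> {a..b}" "\<And>s u t. s \<in> T \<Longrightarrow> u \<in> T \<Longrightarrow> s \<le> t \<Longrightarrow> t \<le> u \<Longrightarrow> t \<in> T"
        "\<And>t. t \<in> T \<Longrightarrow> 8 * c \<le> ?r t" for T
      by (rule large_radius_bound[OF A(1) iso that(1,2) c cA that(3) M0 IH])
    define S where "S = {t \<in> {a..b}. ?r t \<le> 8 * c}"
    have off_S: "8 * c \<le> ?r t" if "t \<in> {a..b}" "t \<notin> S" for t
      using that unfolding S_def by force
    have total: "real (card (?C {a..b})) \<le> 56 * c * M + P"
    proof (cases "S = {}")
      case True
      have "real (card (?C {a..b})) \<le> 28 * c * M"
        by (rule large) (use True off_S in auto)
      also have "\<dots> \<le> 56 * c * M + P" using c M0 P by (intro order_trans[OF _ add_increasing2]) auto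
      finally show ?thesis .
    next
      case False
      have "closed S"
      proof -
        have "S = {a..b} \<inter> E.rad -` {..8 * c}" by (auto simp: S_def E.rad_def)
        then show ?thesis
          using continuous_on_closed_vimage[of "{a..b}" E.rad] E.rad_continuous
          by (simp add: Int_commute)
      qed
      moreover have "bounded S" by (rule bounded_subset[OF bounded_closed_interval[of a b]]) (auto simp: S_def)
      ultimately have "compact S" by (simp add: compact_eq_bounded_closed)
      \<comment> \<open>The radius need not be small throughout \<open>{p..q}\<close>, but it is
        small at both ends, and this already bounds the length. Outside, the radius exceeds
        \<open>8 * c\<close>.\<close>
      then obtain p q where p: "p \<in> S" "\<And>t. t \<in> S \<Longrightarrow> p \<le> t" and q: "q \<in> S" "\<And>t. t \<in> S \<Longrightarrow> t \<le> q"
        using compact_attains_inf[OF _ False] compact_attains_sup[OF _ False] by blast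
      have pq: "a \<le> p" "p \<le> q" "q \<le> b" using p q by (auto simp: S_def)
      have mid: "real (card (?C {p..q})) \<le> P"
        using small_radius_bound[OF A iso pq V, of "8 * c"] p(1) q(1) by (simp add: S_def P_def)
      have left: "real (card (?C {a..<p})) \<le> 28 * c * M"
        by (rule large) (use p(2) pq in \<open>force intro!: off_S\<close>)+
      have right: "real (card (?C {q<..b})) \<le> 28 * c * M"
        by (rule large) (use q(2) pq in \<open>force intro!: off_S\<close>)+
      have "finite (?C {a..<p} \<union> ?C {p..q} \<union> ?C {q<..b})"
        by (rule finite_subset[OF _ finite_collisions_among[of A a b]])
          (use pq in \<open>auto simp: collisions_among_def\<close>)
      moreover have "?C {a..b} \<subseteq> ?C {a..<p} \<union> ?C {p..q} \<union> ?C {q<..b}"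
        by (auto simp: collisions_among_def)
      ultimately have "card (?C {a..b}) \<le> card (?C {a..<p} \<union> ?C {p..q} \<union> ?C {q<..b})"
        by (rule card_mono)
      also have "\<dots> \<le> card (?C {a..<p}) + card (?C {p..q}) + card (?C {q<..b})"
        using card_Un_le[of "?C {a..<p} \<union> ?C {p..q}" "?C {q<..b}"]
          card_Un_le[of "?C {a..<p}" "?C {p..q}"] by linarith
      finally show ?thesis using left mid right by linarith
    qed
    have "P \<le> 56 * c * M"
    proof -
      have "1 * 1 \<le> (56 * c) * (112 * c) ^ (card A - 2)"
        using c by (intro mult_mono one_le_power) auto
      then have "1 * P \<le> ((56 * c) * (112 * c) ^ (card A - 2)) * P"
        using P by (intro mult_right_mono) auto
      then show ?thesis by (simp only: M_def mult.assoc mult_1_left)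
    qed
    then have "56 * c * M + P \<le> (112 * c) * M" by (simp add: algebra_simps)
    also have "\<dots> = (112 * c) ^ (card A - 1) * P"
    proof -
      have "card A - 1 = Suc (card A - 2)" using m by simp
      then show ?thesis by (simp add: M_def)
    qed
    finally show ?thesis using total by linarith
  qed
qed

text \<open>The set of all balls is isolated at all times, and the bound for \<open>{-L..L}\<close>
  does not depend on \<open>L\<close>. Thus all finite sets of collisions have bounded size, which
  gives finiteness along with the count.\<close>

lemma collisions_bound:
  defines "c \<equiv> real n * sqrt n"
  assumes "n > 0"
  shows "finite (collisions d n x)"
    and "real (card (collisions d n x)) \<le> (112 * c) ^ (n - 1) * ((32 * c / \<rho> + 1) * (real n * K))"
proof -
  define Q where "Q = (112 * c) ^ (n - 1) * ((32 * c / \<rho> + 1) * (real n * K))"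
  have "finite (collisions d n x) \<and> card (collisions d n x) \<le> nat \<lfloor>Q\<rfloor>"
  proof (rule finite_if_finite_subsets_card_bdd)
    fix F assume F: "F \<subseteq> collisions d n x" "finite F"
    \<comment> \<open>Inserting 0 makes the maximum meaningful for empty \<open>F\<close> and gives
      \<open>0 \<le> L\<close>.\<close>
    define L where "L = Max (insert 0 ((\<lambda>(j, k, t). \<bar>t\<bar>) ` F))"
    have L: "\<bar>t\<bar> \<le> L" if "(j, k, t) \<in> F" for j k t
      unfolding L_def using F(2) that by (intro Max_ge) force+
    have "0 \<le> L" unfolding L_def using F(2) by (intro Max_ge) auto
    have "F \<subseteq> collisions_among d n x {..<n} {-L..L}"
    proof
      fix q assume q: "q \<in> F"
      obtain j k t where jkt: "q = (j, k, t)" by (cases q) auto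
      then show "q \<in> collisions_among d n x {..<n} {-L..L}"
        using q F(1) L[of j k t] unfolding collisions_among_def collisions_def collide_def touch_def
        by (auto simp: abs_le_iff)
    qed
    then have "real (card F) \<le> real (card (collisions_among d n x {..<n} {-L..L}))"
      using card_mono[OF finite_collisions_among] by simp
    also have "\<dots> \<le> Q"
      using family_bound[of "{..<n}" "-L" L] \<open>0 \<le> L\<close> \<open>n > 0\<close>
      by (auto simp: Q_def c_def isolated_def collide_def touch_def)
    finally show "card F \<le> nat \<lfloor>Q\<rfloor>" by linarith
  qed
  moreover have "0 \<le> Q"
    using \<rho> K unfolding Q_def c_def by (intro mult_nonneg_nonneg add_nonneg_nonneg) auto
  ultimately show "finite (collisions d n x)"
    and "real (card (collisions d n x)) \<le> (112 * c) ^ (n - 1) * ((32 * c / \<rho> + 1) * (real n * K))"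
    unfolding Q_def[symmetric] by linarith+
qed

end

text \<open>With \<open>n \<le> 2 ^ n\<close> and the missing factor \<open>112 * c\<close> supplied
  by the count of windows, everything but \<open>K\<close> fits under the power \<open>n\<close> of
  \<open>224 * c * n\<close>. Here \<open>c * n\<close> is \<open>n\<close> to the power 5/2, and
  224 is absorbed by half of the surplus exponent.\<close>

lemma collision_count_estimate:
  fixes \<epsilon> :: real and n :: nat
  defines "c \<equiv> real n * sqrt n"
  assumes n: "n > 0" "224 < real n powr (\<epsilon> / 2)"
  shows "(112 * c) ^ (n - 1) * ((32 * c / real n powr (- real n) + 1) * (real n * real n powr (\<epsilon> * real n / 2)))
    < real n powr ((5/2 + \<epsilon>) * real n)"
proof -
  have c: "c \<ge> 1"
  proof -
    have "1 * 1 \<le> real n * sqrt n" using n by (intro mult_mono) auto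
    then show ?thesis by (simp add: c_def)
  qed
  have np: "real n powr real n = real n ^ n" using n by (simp add: powr_realpow)
  have "n < 2 ^ n" by (rule less_exp)
  then have n2: "real n \<le> 2 ^ n" by (metis of_nat_le_iff of_nat_numeral of_nat_power less_imp_le)
  have "1 * 1 \<le> c * real n ^ n" using c n by (intro mult_mono one_le_power) auto
  then have "32 * c / real n powr (- real n) + 1 \<le> (112 * c) * real n ^ n"
    by (simp add: powr_minus np divide_inverse)
  then have "(112 * c) ^ (n - 1) * ((32 * c / real n powr (- real n) + 1) * (real n * real n powr (\<epsilon> * real n / 2)))
    \<le> (112 * c) ^ (n - 1) * (((112 * c) * real n ^ n) * (2 ^ n * real n powr (\<epsilon> * real n / 2)))"
    using c n2 by (intro mult_left_mono mult_mono) auto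
  also have "\<dots> = (112 * c) ^ Suc (n - 1) * real n ^ n * 2 ^ n * real n powr (\<epsilon> * real n / 2)"
    by simp
  also have "\<dots> = (224 * (c * real n)) ^ n * real n powr (\<epsilon> * real n / 2)"
  proof -
    have "(224::real) ^ n = 112 ^ n * 2 ^ n" by (simp flip: power_mult_distrib)
    then show ?thesis using n by (simp add: power_mult_distrib)
  qed
  also have "c * real n = real n powr (5/2)"
  proof -
    have "real n powr (5/2) = real n powr 1 * real n powr (1/2) * real n powr 1"
      unfolding powr_add[symmetric] by simp
    also have "\<dots> = c * real n" using n by (simp add: c_def powr_half_sqrt)
    finally show ?thesis by simp
  qed
  also have "(224 * real n powr (5/2)) ^ n < (real n powr (\<epsilon> / 2) * real n powr (5/2)) ^ n"
    using n by (intro power_strict_mono mult_strict_right_mono) auto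
  also have "(real n powr (\<epsilon> / 2) * real n powr (5/2)) ^ n = real n powr ((\<epsilon> / 2 + 5/2) * real n)"
    using n by (simp add: powr_add[symmetric] powr_realpow[symmetric] powr_powr)
  finally show ?thesis using n
    by (simp add: powr_add[symmetric] algebra_simps)
qed

text \<open>Infinitely many collisions form a separate alternative because \<open>card\<close> is 0
  on infinite sets.\<close>

theorem corollary1p4:
  fixes \<epsilon> :: real
  assumes "\<epsilon> > 0"
  shows "\<exists>n0::nat. \<forall>n\<ge>n0. \<forall>d\<ge>2. \<forall>x.
    hard_ball_evolution d n x \<and> no_simultaneous_collisions d n x \<and>
    (infinite (collisions d n x) \<or>
     real (card (collisions d n x)) \<ge> real n powr ((5/2 + \<epsilon>) * real n)) \<longrightarrow>
    (\<exists>B t1 t2. B \<subseteq> {..<n} \<and> t1 < t2 \<and>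
       rho_connected d n x (real n powr (- real n)) B {t1..t2} \<and>
       real (card (collisions_among d n x B {t1..t2})) > real n powr (\<epsilon> * real n / 2))"
proof -
  \<comment> \<open>Chosen so that \<open>n\<close> to the power \<open>\<epsilon> / 2\<close>
    exceeds 224 for all \<open>n \<ge> n0\<close>; the dimension does not enter.\<close>
  obtain n0 :: nat where n0: "224 powr (2 / \<epsilon>) < real n0" using reals_Archimedean2 by blast
  show ?thesis
  proof (intro exI[of _ n0] allI impI, elim conjE)
    fix n d x
    assume "n0 \<le> n" and ev: "hard_ball_evolution d n x" "no_simultaneous_collisions d n x"
      and many: "infinite (collisions d n x) \<or>
        real (card (collisions d n x)) \<ge> real n powr ((5/2 + \<epsilon>) * real n)"
    then have big: "224 powr (2 / \<epsilon>) < real n" using n0 by linarith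
    have n: "n > 0" using big powr_ge_zero[of 224 "2 / \<epsilon>"] by (cases n) auto
    have "(224 powr (2 / \<epsilon>)) powr (\<epsilon> / 2) < real n powr (\<epsilon> / 2)"
      using big assms by (intro powr_less_mono2) auto
    then have big': "224 < real n powr (\<epsilon> / 2)" using assms by (simp add: powr_powr)
    show "\<exists>B t1 t2. B \<subseteq> {..<n} \<and> t1 < t2 \<and>
       rho_connected d n x (real n powr (- real n)) B {t1..t2} \<and>
       real (card (collisions_among d n x B {t1..t2})) > real n powr (\<epsilon> * real n / 2)"
    proof (rule ccontr)
      assume none: "\<not> ?thesis"
      \<comment> \<open>The failure of the conclusion is exactly the sparseness hypothesis, so the
        upper bound on all collisions contradicts \<open>many\<close>.\<close>
      interpret sparse_clusters d n x "real n powr (- real n)" "real n powr (\<epsilon> * real n / 2)"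
      proof
        show "hard_ball_evolution d n x" "no_simultaneous_collisions d n x" by fact+
        show "0 < real n powr (- real n)" using n by simp
        show "1 \<le> real n powr (\<epsilon> * real n / 2)" using n assms by (intro ge_one_powr_ge_zero) auto
        show "real (card (collisions_among d n x B {s..u})) \<le> real n powr (\<epsilon> * real n / 2)"
          if "B \<subseteq> {..<n}" "s < u" "rho_connected d n x (real n powr (- real n)) B {s..u}" for B s u
          using none that by (meson not_le)
      qed
      show False
        using collisions_bound[OF n] collision_count_estimate[OF n big'] many by linarith
    qed
  qed
qed

end
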